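(* Let $G$ be an eight-dimensional Lie group equipped with a left-invariant Riemannian metric and containing the subgroup $K=\mathbf{SU}(2)\times\mathbf{SL}_2(\mathbb{R})$, equipped with its standard Riemannian metric. Let $\mathcal{V}$ be the left-invariant distribution on $G$ generated by the Lie algebra $\mathfrak{k}=\mathfrak{su}(2)\times\mathfrak{sl}_2(\mathbb{R})$. Then the resulting foliation $\mathcal{F}$ tangent to $\mathcal{V}$ is Riemannian and minimal. Furthermore, $\mathcal{F}$ is totally geodesic if and only if $s_{14}=s_{24}=t_{14}=t_{24}=0$, where $s_{14},s_{24},t_{14},t_{24}$ are the structure coefficients defined in the context.
   Context: The left-invariant metric $g=\langle\cdot,\cdot\rangle$ on $G$ restricts to the standard metric on $K$: $\mathfrak{k}$ has a basis $\{A,B,C,R,S,T\}$, orthonormal with respect to $g$, such that $\{A,B,C\}$ spans $\mathfrak{su}(2)$, $\{R,S,T\}$ spans $\mathfrak{sl}_2(\mathbb{R})$, and $[A,B]=2C$, $[C,A]=2B$, $[B,C]=2A$, $[R,S]=2T$, $[T,R]=2S$, $[S,T]=-2R$, with the two factors commuting. Let $\{X,Y\}$ be an orthonormal basis of the orthogonal complement $\mathfrak{m}$ of $\mathfrak{k}$ in the Lie algebra $\mathfrak{g}$ of $G$, chosen such that $[X,Y]$ has no $Y$-component. The coefficients are those of $R$ in the brackets: $s_{14}=\langle[S,X],R\rangle$, $s_{24}=\langle[S,Y],R\rangle$, $t_{14}=\langle[T,X],R\rangle$, $t_{24}=\langle[T,Y],R\rangle$. Let $\mathcal{H}$ be the orthogonal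 distribution of $\mathcal{V}$ (generated by $\mathfrak{m}$); $\mathcal{V},\mathcal{H}$ also denote the orthogonal projections, and $\nabla$ is the Levi-Civita connection. The second fundamental forms are $B^{\mathcal{V}}(E,F)=\tfrac12\mathcal{H}(\nabla_EF+\nabla_FE)$ for $E,F\in\mathcal{V}$ and $B^{\mathcal{H}}(Z,W)=\tfrac12\mathcal{V}(\nabla_ZW+\nabla_WZ)$ for $Z,W\in\mathcal{H}$. $\mathcal{F}$ is Riemannian if $B^{\mathcal{H}}=0$; minimal if $\operatorname{trace}B^{\mathcal{V}}=0$; totally geodesic if $B^{\mathcal{V}}=0$.
   Formalization: The foliation F is additionally assumed conformal (B^H = g⊗N for a vector field N in V); without this the claim fails, e.g. for G = SU(2)×(SL_2(R)⋉R^2), where F is not Riemannian. Every Riemannian F is conformal, so no case where the claim holds is lost. *)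

theory Defs
  imports "HOL-Analysis.Analysis" "HOL-Algebra.Group"
begin

section \<open>Smooth manifolds\<close>

text \<open>Meant for open sets \<open>S\<close> only: \<open>C_k k S f\<close> says that all iterated directional derivatives
  of order less than \<open>k\<close> are Frechet differentiable on \<open>S\<close>, and those of order \<open>k\<close> continuous.\<close>

fun C_k :: "nat \<Rightarrow> 'a::real_normed_vector set \<Rightarrow> ('a \<Rightarrow> 'b::real_normed_vector) \<Rightarrow> bool" where
  "C_k 0 S f \<longleftrightarrow> continuous_on S f"
| "C_k (Suc k) S f \<longleftrightarrow> (\<forall>x\<in>S. f differentiable (at x)) \<and>
     (\<forall>v. C_k k S (\<lambda>x. frechet_derivative f (at x) v))"

definition smooth_on :: "'a::real_normed_vector set \<Rightarrow> ('a \<Rightarrow> 'b::real_normed_vector) \<Rightarrow> bool" where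
  "smooth_on S f \<longleftrightarrow> (\<forall>k. C_k k S f)"

text \<open>The underlying space of a manifold is a whole type; \<open>(U, \<phi>)\<close> is a chart with domain \<open>U\<close>.\<close>

type_synonym ('g, 'e) atlas = "('g set \<times> ('g \<Rightarrow> 'e)) set"

definition smooth_atlas ::
  "('g::{t2_space,second_countable_topology}, 'e::euclidean_space) atlas \<Rightarrow> bool" where
  "smooth_atlas \<A> \<longleftrightarrow>
     (\<forall>(U, \<phi>)\<in>\<A>. open U \<and> open (\<phi> ` U) \<and> homeomorphism U (\<phi> ` U) \<phi> (inv_into U \<phi>)) \<and>
     (\<Union>(U, \<phi>)\<in>\<A>. U) = UNIV \<and>
     (\<forall>(U, \<phi>)\<in>\<A>. \<forall>(V, \<psi>)\<in>\<A>. smooth_on (\<phi> ` (U \<inter> V)) (\<psi> \<circ> inv_into U \<phi>))"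

definition prod_atlas ::
  "('g, 'e) atlas \<Rightarrow> ('h, 'd) atlas \<Rightarrow> ('g \<times> 'h, 'e \<times> 'd) atlas" where
  "prod_atlas \<A> \<B> = {(U \<times> V, map_prod \<phi> \<psi>) | U V \<phi> \<psi>. (U, \<phi>) \<in> \<A> \<and> (V, \<psi>) \<in> \<B>}"

definition smooth_map ::
  "('g::topological_space, 'e::euclidean_space) atlas \<Rightarrow>
   ('h::topological_space, 'd::euclidean_space) atlas \<Rightarrow> ('g \<Rightarrow> 'h) \<Rightarrow> bool" where
  "smooth_map \<A> \<B> F \<longleftrightarrow> continuous_on UNIV F \<and>
     (\<forall>(U, \<phi>)\<in>\<A>. \<forall>(V, \<psi>)\<in>\<B>. smooth_on (\<phi> ` (U \<inter> F -` V)) (\<psi> \<circ> F \<circ> inv_into U \<phi>))"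

definition smooth_fun :: "('g, 'e::euclidean_space) atlas \<Rightarrow> ('g \<Rightarrow> real) \<Rightarrow> bool" where
  "smooth_fun \<A> f \<longleftrightarrow> (\<forall>(U, \<phi>)\<in>\<A>. smooth_on (\<phi> ` U) (f \<circ> inv_into U \<phi>))"


section \<open>Tangent vectors and vector fields\<close>

text \<open>A tangent vector is identified with the directional derivative it defines on smooth
  functions. By convention it is \<open>0\<close> on functions that are not smooth, so that equality of tangent
  vectors is equality of functionals.\<close>

type_synonym 'g tvec = "('g \<Rightarrow> real) \<Rightarrow> real"
type_synonym 'g vfield = "'g \<Rightarrow> 'g tvec"
type_synonym 'g metric = "'g \<Rightarrow> 'g tvec \<Rightarrow> 'g tvec \<Rightarrow> real"
type_synonym 'g connection = "'g vfield \<Rightarrow> 'g vfield \<Rightarrow> 'g vfield"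
type_synonym 'g distribution = "'g \<Rightarrow> 'g tvec set"

definition tangent_space :: "('g, 'e::euclidean_space) atlas \<Rightarrow> 'g distribution" where
  "tangent_space \<A> p = {v. \<exists>(U, \<phi>)\<in>\<A>. p \<in> U \<and> (\<exists>w. \<forall>f. v f =
     (if smooth_fun \<A> f then frechet_derivative (f \<circ> inv_into U \<phi>) (at (\<phi> p)) w else 0))}"

definition vector_field :: "('g, 'e::euclidean_space) atlas \<Rightarrow> 'g vfield \<Rightarrow> bool" where
  "vector_field \<A> X \<longleftrightarrow> (\<forall>p. X p \<in> tangent_space \<A> p) \<and>
     (\<forall>f. smooth_fun \<A> f \<longrightarrow> smooth_fun \<A> (\<lambda>p. X p f))"

definition vf_add :: "'g vfield \<Rightarrow> 'g vfield \<Rightarrow> 'g vfield" where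
  "vf_add X Y = (\<lambda>p f. X p f + Y p f)"

definition vf_diff :: "'g vfield \<Rightarrow> 'g vfield \<Rightarrow> 'g vfield" where
  "vf_diff X Y = (\<lambda>p f. X p f - Y p f)"

definition vf_mult :: "('g \<Rightarrow> real) \<Rightarrow> 'g vfield \<Rightarrow> 'g vfield" where
  "vf_mult h X = (\<lambda>p f. h p * X p f)"

abbreviation vf_scale :: "real \<Rightarrow> 'g vfield \<Rightarrow> 'g vfield" where
  "vf_scale c X \<equiv> vf_mult (\<lambda>_. c) X"

abbreviation vf_zero :: "'g vfield" where
  "vf_zero \<equiv> (\<lambda>p f. 0)"

definition vf_span :: "'g vfield list \<Rightarrow> 'g vfield set" where
  "vf_span L = {(\<lambda>p f. \<Sum>i<length L. c i * (L ! i) p f) | c :: nat \<Rightarrow> real. True}"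

definition lie_bracket :: "'g vfield \<Rightarrow> 'g vfield \<Rightarrow> 'g vfield" where
  "lie_bracket X Y = (\<lambda>p f. X p (\<lambda>q. Y q f) - Y p (\<lambda>q. X q f))"


section \<open>Riemannian metrics and the Levi-Civita connection\<close>

definition riemannian_metric :: "('g, 'e::euclidean_space) atlas \<Rightarrow> 'g metric \<Rightarrow> bool" where
  "riemannian_metric \<A> g \<longleftrightarrow>
     (\<forall>p. \<forall>u\<in>tangent_space \<A> p. \<forall>v\<in>tangent_space \<A> p. \<forall>w\<in>tangent_space \<A> p. \<forall>a b.
        g p u v = g p v u \<and> g p (\<lambda>f. a * u f + b * v f) w = a * g p u w + b * g p v w) \<and>
     (\<forall>p. \<forall>u\<in>tangent_space \<A> p. u \<noteq> (\<lambda>f. 0) \<longrightarrow> g p u u > 0) \<and>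
     (\<forall>X Y. vector_field \<A> X \<longrightarrow> vector_field \<A> Y \<longrightarrow> smooth_fun \<A> (\<lambda>p. g p (X p) (Y p)))"

definition affine_connection :: "('g, 'e::euclidean_space) atlas \<Rightarrow> 'g connection \<Rightarrow> bool" where
  "affine_connection \<A> D \<longleftrightarrow>
     (\<forall>X Y. vector_field \<A> X \<longrightarrow> vector_field \<A> Y \<longrightarrow>
        vector_field \<A> (D X Y) \<and>
        (\<forall>Z. vector_field \<A> Z \<longrightarrow>
           D (vf_add X Z) Y = vf_add (D X Y) (D Z Y) \<and>
           D X (vf_add Y Z) = vf_add (D X Y) (D X Z)) \<and>
        (\<forall>h. smooth_fun \<A> h \<longrightarrow>
           D (vf_mult h X) Y = vf_mult h (D X Y) \<and>
           D X (vf_mult h Y) = vf_add (vf_mult (\<lambda>p. X p h) Y) (vf_mult h (D X Y))))"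

definition levi_civita ::
  "('g, 'e::euclidean_space) atlas \<Rightarrow> 'g metric \<Rightarrow> 'g connection \<Rightarrow> bool" where
  "levi_civita \<A> g D \<longleftrightarrow> affine_connection \<A> D \<and>
     (\<forall>X Y. vector_field \<A> X \<longrightarrow> vector_field \<A> Y \<longrightarrow>
        vf_diff (D X Y) (D Y X) = lie_bracket X Y \<and>
        (\<forall>Z. vector_field \<A> Z \<longrightarrow> (\<forall>p.
           X p (\<lambda>q. g q (Y q) (Z q)) = g p (D X Y p) (Z p) + g p (Y p) (D X Z p))))"


section \<open>Distributions and second fundamental forms\<close>

definition section_of :: "('g, 'e::euclidean_space) atlas \<Rightarrow> 'g distribution \<Rightarrow> 'g vfield \<Rightarrow> bool" where
  "section_of \<A> V E \<longleftrightarrow> vector_field \<A> E \<and> (\<forall>p. E p \<in> V p)"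

definition orthogonal_distribution ::
  "('g, 'e::euclidean_space) atlas \<Rightarrow> 'g metric \<Rightarrow> 'g distribution \<Rightarrow> 'g distribution" where
  "orthogonal_distribution \<A> g V p = {v \<in> tangent_space \<A> p. \<forall>u\<in>V p. g p v u = 0}"

definition orthogonal_projection ::
  "'g metric \<Rightarrow> 'g distribution \<Rightarrow> 'g \<Rightarrow> 'g tvec \<Rightarrow> 'g tvec" where
  "orthogonal_projection g V p v = (THE u. u \<in> V p \<and> (\<forall>w\<in>V p. g p (\<lambda>f. v f - u f) w = 0))"

text \<open>\<open>W\<close> is the orthogonal complement of the distribution to which the arguments belong.\<close>

definition second_fundamental_form ::
  "'g metric \<Rightarrow> 'g connection \<Rightarrow> 'g distribution \<Rightarrow> 'g vfield \<Rightarrow> 'g vfield \<Rightarrow> 'g vfield" where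
  "second_fundamental_form g D W E F =
     (\<lambda>p f. 1/2 * orthogonal_projection g W p (vf_add (D E F) (D F E) p) f)"

text \<open>The following properties of the foliation tangent to an integrable distribution \<open>V\<close> are
  expressed through \<open>V\<close> and its orthogonal distribution.\<close>

definition riemannian_foliation ::
  "('g, 'e::euclidean_space) atlas \<Rightarrow> 'g metric \<Rightarrow> 'g connection \<Rightarrow> 'g distribution \<Rightarrow> bool" where
  "riemannian_foliation \<A> g D V \<longleftrightarrow>
     (\<forall>Z W. section_of \<A> (orthogonal_distribution \<A> g V) Z \<longrightarrow>
            section_of \<A> (orthogonal_distribution \<A> g V) W \<longrightarrow>
            second_fundamental_form g D V Z W = vf_zero)"

definition conformal_foliation ::
  "('g, 'e::euclidean_space) atlas \<Rightarrow> 'g metric \<Rightarrow> 'g connection \<Rightarrow> 'g distribution \<Rightarrow> bool" where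
  "conformal_foliation \<A> g D V \<longleftrightarrow>
     (\<exists>N. section_of \<A> V N \<and>
       (\<forall>Z W. section_of \<A> (orthogonal_distribution \<A> g V) Z \<longrightarrow>
              section_of \<A> (orthogonal_distribution \<A> g V) W \<longrightarrow>
              second_fundamental_form g D V Z W = vf_mult (\<lambda>p. g p (Z p) (W p)) N))"

definition totally_geodesic_foliation ::
  "('g, 'e::euclidean_space) atlas \<Rightarrow> 'g metric \<Rightarrow> 'g connection \<Rightarrow> 'g distribution \<Rightarrow> bool" where
  "totally_geodesic_foliation \<A> g D V \<longleftrightarrow>
     (\<forall>E F. section_of \<A> V E \<longrightarrow> section_of \<A> V F \<longrightarrow>
        second_fundamental_form g D (orthogonal_distribution \<A> g V) E F = vf_zero)"

text \<open>The trace at \<open>p\<close> is computed with sections of \<open>V\<close> whose values at \<open>p\<close> form an orthonormal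
  basis of \<open>V p\<close>; as the second fundamental form is tensorial, no condition is needed at other
  points.\<close>

definition minimal_foliation ::
  "('g, 'e::euclidean_space) atlas \<Rightarrow> 'g metric \<Rightarrow> 'g connection \<Rightarrow> 'g distribution \<Rightarrow> bool" where
  "minimal_foliation \<A> g D V \<longleftrightarrow>
     (\<forall>p (n::nat) E. (\<forall>i<n. section_of \<A> V (E i)) \<longrightarrow>
        (\<forall>i<n. \<forall>j<n. g p (E i p) (E j p) = of_bool (i = j)) \<longrightarrow>
        (\<forall>v\<in>V p. \<exists>c. v = (\<lambda>f. \<Sum>i<n. c i * E i p f)) \<longrightarrow>
        (\<lambda>f. \<Sum>i<n. second_fundamental_form g D (orthogonal_distribution \<A> g V) (E i) (E i) p f)
          = (\<lambda>f. 0))"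


section \<open>Lie groups\<close>

definition lie_group ::
  "'g::{t2_space,second_countable_topology} monoid \<Rightarrow> ('g, 'e::euclidean_space) atlas \<Rightarrow> bool" where
  "lie_group G \<A> \<longleftrightarrow> group G \<and> carrier G = UNIV \<and> smooth_atlas \<A> \<and>
     smooth_map (prod_atlas \<A> \<A>) \<A> (\<lambda>(x, y). x \<otimes>\<^bsub>G\<^esub> y) \<and>
     smooth_map \<A> \<A> (m_inv G)"

text \<open>The differential of left translation by \<open>a\<close>.\<close>

definition left_push :: "'g monoid \<Rightarrow> ('g, 'e::euclidean_space) atlas \<Rightarrow> 'g \<Rightarrow> 'g tvec \<Rightarrow> 'g tvec" where
  "left_push G \<A> a v = (\<lambda>f. if smooth_fun \<A> f then v (\<lambda>x. f (a \<otimes>\<^bsub>G\<^esub> x)) else 0)"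

definition left_invariant_metric ::
  "'g monoid \<Rightarrow> ('g, 'e::euclidean_space) atlas \<Rightarrow> 'g metric \<Rightarrow> bool" where
  "left_invariant_metric G \<A> g \<longleftrightarrow> riemannian_metric \<A> g \<and>
     (\<forall>a p. \<forall>u\<in>tangent_space \<A> p. \<forall>v\<in>tangent_space \<A> p.
        g (a \<otimes>\<^bsub>G\<^esub> p) (left_push G \<A> a u) (left_push G \<A> a v) = g p u v)"

text \<open>The Lie algebra of \<open>G\<close>, consisting of left-invariant vector fields, and the inner product
  that a metric induces on it.\<close>

definition lie_algebra :: "'g monoid \<Rightarrow> ('g, 'e::euclidean_space) atlas \<Rightarrow> 'g vfield set" where
  "lie_algebra G \<A> = {X. vector_field \<A> X \<and> (\<forall>a p. X (a \<otimes>\<^bsub>G\<^esub> p) = left_push G \<A> a (X p))}"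

definition lie_inner :: "'g monoid \<Rightarrow> 'g metric \<Rightarrow> 'g vfield \<Rightarrow> 'g vfield \<Rightarrow> real" where
  "lie_inner G g X Y = g \<one>\<^bsub>G\<^esub> (X \<one>\<^bsub>G\<^esub>) (Y \<one>\<^bsub>G\<^esub>)"

definition orthonormal_fields :: "'g monoid \<Rightarrow> 'g metric \<Rightarrow> 'g vfield list \<Rightarrow> bool" where
  "orthonormal_fields G g L \<longleftrightarrow>
     (\<forall>i<length L. \<forall>j<length L. lie_inner G g (L ! i) (L ! j) = of_bool (i = j))"

definition generated_distribution :: "'g vfield set \<Rightarrow> 'g distribution" where
  "generated_distribution \<kk> p = {E p | E. E \<in> \<kk>}"


section \<open>The subgroup \<open>SU(2) \<times> SL\<^sub>2(\<real>)\<close>\<close>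

definition SU2 :: "(complex^2^2) set" where
  "SU2 = {M. M ** transpose (\<chi> i j. cnj (M $ i $ j)) = mat 1 \<and> det M = 1}"

definition SL2 :: "(real^2^2) set" where
  "SL2 = {M. det M = 1}"

text \<open>\<open>\<iota>\<close> restricts to an injective Lie group homomorphism from \<open>SU(2) \<times> SL\<^sub>2(\<real>)\<close> to \<open>G\<close>; its
  image is the subgroup \<open>K\<close>. The group \<open>SU(2) \<times> SL\<^sub>2(\<real>)\<close> is an embedded submanifold of the matrix
  space, so its smooth functions are those that extend locally to smooth functions of
  matrices. A map into \<open>G\<close> is smooth iff it pulls smooth functions back to smooth functions.\<close>

definition lie_subgroup_SU2_SL2 ::
  "'g monoid \<Rightarrow> ('g, 'e::euclidean_space) atlas \<Rightarrow> ((complex^2^2) \<times> (real^2^2) \<Rightarrow> 'g) \<Rightarrow> bool" where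
  "lie_subgroup_SU2_SL2 G \<A> \<iota> \<longleftrightarrow> inj_on \<iota> (SU2 \<times> SL2) \<and>
     (\<forall>M\<in>SU2. \<forall>M'\<in>SU2. \<forall>N\<in>SL2. \<forall>N'\<in>SL2.
        \<iota> (M ** M', N ** N') = \<iota> (M, N) \<otimes>\<^bsub>G\<^esub> \<iota> (M', N')) \<and>
     (\<forall>f. smooth_fun \<A> f \<longrightarrow> (\<forall>x\<in>SU2 \<times> SL2. \<exists>W F. open W \<and> x \<in> W \<and>
        smooth_on W F \<and> (\<forall>y\<in>W \<inter> (SU2 \<times> SL2). F y = f (\<iota> y))))"

text \<open>The Lie algebra of \<open>\<iota> ` S\<close>, for a closed subgroup \<open>S\<close> of \<open>SU(2) \<times> SL\<^sub>2(\<real>)\<close>: the elements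
  of the Lie algebra of \<open>G\<close> whose value at the identity is the velocity of the image under \<open>\<iota>\<close> of a
  smooth curve in \<open>S\<close>.\<close>

definition lie_subalgebra ::
  "'g monoid \<Rightarrow> ('g, 'e::euclidean_space) atlas \<Rightarrow> ((complex^2^2) \<times> (real^2^2) \<Rightarrow> 'g) \<Rightarrow>
   ((complex^2^2) \<times> (real^2^2)) set \<Rightarrow> 'g vfield set" where
  "lie_subalgebra G \<A> \<iota> S = {Z \<in> lie_algebra G \<A>. \<exists>c :: real \<Rightarrow> (complex^2^2) \<times> (real^2^2).
     smooth_on UNIV c \<and> (\<forall>t. c t \<in> S) \<and> c 0 = (mat 1, mat 1) \<and>
     (\<forall>f. smooth_fun \<A> f \<longrightarrow> ((\<lambda>t. f (\<iota> (c t))) has_real_derivative Z \<one>\<^bsub>G\<^esub> f) (at 0))}"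

end

theory Submission
  imports Defs
begin

text \<open>For left-invariant \<open>U\<close>, \<open>V\<close>, \<open>W\<close> Koszul's formula gives
  \<open>g (\<nabla>\<^sub>U V + \<nabla>\<^sub>V U, W) = g ([W, U], V) + g ([W, V], U)\<close>. Hence conformality says that
  \<open>\<kk>\<close> acts on \<open>\<gg> / \<kk> = \<mm>\<close>, which is a plane, by conformal matrices. These commute and \<open>\<kk>\<close> is
  perfect, so the action is trivial: \<open>\<F>\<close> is Riemannian and \<open>\<kk>\<close> is an ideal. Therefore \<open>ad Z\<close>,
  for \<open>Z\<close> in \<open>\<mm>\<close>, restricts to a derivation of \<open>\<kk>\<close>, and \<open>B\<^sup>\<V>\<close> is its symmetric part up to sign.
  A derivation of \<open>\<kk>\<close> is traceless, and the only entries of its symmetric part that need not vanish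
  are those at \<open>(R, S)\<close> and \<open>(R, T)\<close>.\<close>

section \<open>Smooth functions\<close>

text \<open>The geometric notions quantify over arbitrary sections, whose coefficients vary from
  point to point, while the algebra concerns left-invariant fields only. What remains are identities
  between the structure constants of an orthonormal frame.

  The exceptional entries at (R, S) and (R, T) come from the Killing form, for which every
  derivation of \<kk> is skew. On su(2) this form is a multiple of the metric, so skew for one means
  skew for the other. In the orthonormal basis R, S, T of the second factor it is diagonal with
  values -8, 8, 8. The change of sign turns skewness into symmetry exactly in the pairs that contain
  R and one of S, T.\<close>

lemma C_k_cong:
  assumes "open S" "\<And>x. x \<in> S \<Longrightarrow> f x = g x" "C_k k S f"
  shows "C_k k S g"
  using assms(2,3)
proof (induction k arbitrary: f g)
  case 0
  then show ?case by (auto cong: continuous_on_cong)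
next
  case (Suc k)
  have g: "g differentiable (at x)" if "x \<in> S" for x
    using Suc.prems that assms(1) unfolding differentiable_def
    by (meson C_k.simps(2) differentiable_def has_derivative_transform_within_open)
  have "frechet_derivative f (at x) v = frechet_derivative g (at x) v" if "x \<in> S" for x v
    using Suc.prems that assms(1) frechet_derivative_transform_within_open[of f x S g] by auto
  then have "C_k k S (\<lambda>x. frechet_derivative g (at x) v)" for v
    using Suc.IH[of "\<lambda>x. frechet_derivative f (at x) v"] Suc.prems(2) by simp
  with g show ?case by simp
qed

text \<open>Needed for the product rule, whose terms contain one undifferentiated factor: that
  factor has order \<open>Suc k\<close>, while the induction hypothesis of \<open>C_k_mult\<close>
  asks for order \<open>k\<close>.\<close>

lemma C_k_Suc_D: "C_k (Suc k) S f \<Longrightarrow> C_k k S f"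
proof (induction k arbitrary: f)
  case 0
  then show ?case
    by (auto intro!: continuous_at_imp_continuous_on differentiable_imp_continuous_within)
next
  case (Suc k)
  then show ?case by (metis C_k.simps(2))
qed

lemma C_k_const: "C_k k S (\<lambda>x. c)"
  by (induction k arbitrary: c) auto

lemma C_k_add:
  assumes "open S" "C_k k S f" "C_k k S g"
  shows "C_k k S (\<lambda>x. f x + g x)"
  using assms(2,3)
proof (induction k arbitrary: f g)
  case 0
  then show ?case by (auto intro: continuous_on_add)
next
  case (Suc k)
  have eq: "frechet_derivative f (at x) v + frechet_derivative g (at x) v =
      frechet_derivative (\<lambda>x. f x + g x) (at x) v" if "x \<in> S" for x v
  proof -
    have "((\<lambda>x. f x + g x) has_derivative
        (\<lambda>v. frechet_derivative f (at x) v + frechet_derivative g (at x) v)) (at x)"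
      using Suc.prems that by (intro has_derivative_add) (auto simp: frechet_derivative_works)
    then show ?thesis by (metis frechet_derivative_at)
  qed
  have "C_k k S (\<lambda>x. frechet_derivative (\<lambda>x. f x + g x) (at x) v)" for v
    using C_k_cong[OF assms(1) eq Suc.IH] Suc.prems by auto
  then show ?case using Suc.prems by auto
qed

lemma C_k_mult:
  fixes f g :: "'a::real_normed_vector \<Rightarrow> real"
  assumes "open S" "C_k k S f" "C_k k S g"
  shows "C_k k S (\<lambda>x. f x * g x)"
  using assms(2,3)
proof (induction k arbitrary: f g)
  case 0
  then show ?case by (auto intro: continuous_on_mult)
next
  case (Suc k)
  have eq: "f x * frechet_derivative g (at x) v + frechet_derivative f (at x) v * g x =
      frechet_derivative (\<lambda>x. f x * g x) (at x) v" if "x \<in> S" for x v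
  proof -
    have "((\<lambda>x. f x * g x) has_derivative
        (\<lambda>v. f x * frechet_derivative g (at x) v + frechet_derivative f (at x) v * g x)) (at x)"
      using Suc.prems that by (intro has_derivative_mult) (auto simp: frechet_derivative_works)
    then show ?thesis by (metis frechet_derivative_at)
  qed
  have "C_k k S (\<lambda>x. frechet_derivative (\<lambda>x. f x * g x) (at x) v)" for v
    using C_k_cong[OF assms(1) eq C_k_add[OF assms(1) Suc.IH Suc.IH]] Suc.prems
      C_k_Suc_D[of k S f] C_k_Suc_D[of k S g] by auto
  then show ?case using Suc.prems by auto
qed

section \<open>The algebra of smooth functions on a manifold\<close>

locale smooth_manifold =
  fixes \<A> :: "('g::{t2_space,second_countable_topology}, 'e::euclidean_space) atlas"
  assumes atlas: "smooth_atlas \<A>"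
begin

lemma chart:
  assumes "(U, \<phi>) \<in> \<A>"
  shows "open U" "open (\<phi> ` U)" "homeomorphism U (\<phi> ` U) \<phi> (inv_into U \<phi>)"
  using atlas assms unfolding smooth_atlas_def by auto

lemma ex_chart: obtains U \<phi> where "(U, \<phi>) \<in> \<A>" "p \<in> U"
  using atlas unfolding smooth_atlas_def by blast

lemma smooth_const: "smooth_fun \<A> (\<lambda>x. c)"
  by (auto simp: smooth_fun_def smooth_on_def comp_def C_k_const)

lemma smooth_add: "smooth_fun \<A> f \<Longrightarrow> smooth_fun \<A> h \<Longrightarrow> smooth_fun \<A> (\<lambda>x. f x + h x)"
  using chart(2) by (fastforce simp: smooth_fun_def smooth_on_def comp_def intro!: C_k_add)

lemma smooth_mult: "smooth_fun \<A> f \<Longrightarrow> smooth_fun \<A> h \<Longrightarrow> smooth_fun \<A> (\<lambda>x. f x * h x)"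
  using chart(2) by (fastforce simp: smooth_fun_def smooth_on_def comp_def intro!: C_k_mult)

lemma smooth_sum:
  "finite I \<Longrightarrow> (\<And>i. i \<in> I \<Longrightarrow> smooth_fun \<A> (f i)) \<Longrightarrow> smooth_fun \<A> (\<lambda>x. \<Sum>i\<in>I. f i x)"
  by (induction I rule: finite_induct) (auto intro: smooth_const smooth_add)

lemma smooth_diff: "smooth_fun \<A> f \<Longrightarrow> smooth_fun \<A> h \<Longrightarrow> smooth_fun \<A> (\<lambda>x. f x - h x)"
  using smooth_add[OF _ smooth_mult[OF smooth_const[of "-1"]], of f h] by simp

lemma smooth_fun_chart_differentiable:
  assumes "smooth_fun \<A> f" "(U, \<phi>) \<in> \<A>" "p \<in> U"
  shows "(f \<circ> inv_into U \<phi>) differentiable (at (\<phi> p))"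
proof -
  have "C_k (Suc 0) (\<phi> ` U) (f \<circ> inv_into U \<phi>)"
    using assms unfolding smooth_fun_def smooth_on_def by blast
  then show ?thesis using assms(3) by auto
qed

lemma smooth_fun_chart_has_derivative:
  assumes "smooth_fun \<A> f" "(U, \<phi>) \<in> \<A>" "p \<in> U"
  shows "((f \<circ> inv_into U \<phi>) has_derivative
    frechet_derivative (f \<circ> inv_into U \<phi>) (at (\<phi> p))) (at (\<phi> p))"
  using smooth_fun_chart_differentiable[OF assms] by (simp add: frechet_derivative_works)

section \<open>Tangent vectors\<close>

definition chart_tvec :: "'g set \<Rightarrow> ('g \<Rightarrow> 'e) \<Rightarrow> 'g \<Rightarrow> 'e \<Rightarrow> 'g tvec" where
  "chart_tvec U \<phi> p w = (\<lambda>f. if smooth_fun \<A> f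
     then frechet_derivative (f \<circ> inv_into U \<phi>) (at (\<phi> p)) w else 0)"

text \<open>By the chain rule, the derivative of the transition map carries the coordinates of a
  vector in one chart to those in another. As the definition lets the chart depend on the vector,
  closure under sums only becomes visible after fixing one chart.\<close>

lemma tangent_space_chart:
  assumes U: "(U, \<phi>) \<in> \<A>" "p \<in> U"
  shows "tangent_space \<A> p = range (chart_tvec U \<phi> p)"
proof
  show "range (chart_tvec U \<phi> p) \<subseteq> tangent_space \<A> p"
    using U unfolding tangent_space_def chart_tvec_def by blast
next
  show "tangent_space \<A> p \<subseteq> range (chart_tvec U \<phi> p)"
  proof
    fix v assume "v \<in> tangent_space \<A> p"
    then obtain V \<psi> w where V: "(V, \<psi>) \<in> \<A>" "p \<in> V" and v: "v = chart_tvec V \<psi> p w"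
      unfolding tangent_space_def chart_tvec_def by blast
    let ?W = "\<psi> ` (V \<inter> U)" and ?\<tau> = "\<phi> \<circ> inv_into V \<psi>"
    have W: "open ?W" "\<psi> p \<in> ?W"
    proof -
      have "openin (top_of_set V) (V \<inter> U)"
        using chart(1)[OF U(1)] by (simp add: openin_open_Int)
      then have "openin (top_of_set (\<psi> ` V)) ?W"
        by (rule homeomorphism_imp_open_map[OF chart(3)[OF V(1)]])
      then show "open ?W" using chart(2)[OF V(1)] openin_open_trans by blast
      show "\<psi> p \<in> ?W" using U V by auto
    qed
    have inj: "inj_on \<phi> U" "inj_on \<psi> V"
      using chart(3)[OF U(1)] chart(3)[OF V(1)]
      by (auto intro: inj_on_inverseI homeomorphism_apply1)
    have "smooth_on ?W ?\<tau>"
      using atlas U(1) V(1) unfolding smooth_atlas_def by auto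
    then have "C_k (Suc 0) ?W ?\<tau>"
      unfolding smooth_on_def by blast
    then have \<tau>: "?\<tau> differentiable (at (\<psi> p))" using W(2) by auto
    have \<tau>p: "?\<tau> (\<psi> p) = \<phi> p" using inj V by simp
    have "v f = chart_tvec U \<phi> p (frechet_derivative ?\<tau> (at (\<psi> p)) w) f" for f
    proof (cases "smooth_fun \<A> f")
      case True
      have df: "(f \<circ> inv_into U \<phi>) differentiable (at (?\<tau> (\<psi> p)))"
        using smooth_fun_chart_differentiable[OF True U] \<tau>p by simp
      have eq: "(f \<circ> inv_into V \<psi>) y = ((f \<circ> inv_into U \<phi>) \<circ> ?\<tau>) y" if "y \<in> ?W" for y
        using that inj by auto
      have "frechet_derivative (f \<circ> inv_into V \<psi>) (at (\<psi> p)) =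
          frechet_derivative ((f \<circ> inv_into U \<phi>) \<circ> ?\<tau>) (at (\<psi> p))"
        by (rule frechet_derivative_transform_within_open
            [OF smooth_fun_chart_differentiable[OF True V] W eq])
      also have "\<dots> = frechet_derivative (f \<circ> inv_into U \<phi>) (at (\<phi> p)) \<circ>
          frechet_derivative ?\<tau> (at (\<psi> p))"
        using frechet_derivative_compose[OF \<tau> df] unfolding \<tau>p .
      finally show ?thesis using True unfolding v chart_tvec_def by simp
    qed (simp add: v chart_tvec_def)
    then show "v \<in> range (chart_tvec U \<phi> p)" by blast
  qed
qed

lemma chart_tvec_lincomb:
  assumes "(U, \<phi>) \<in> \<A>" "p \<in> U" "finite I"
  shows "chart_tvec U \<phi> p (\<Sum>i\<in>I. c i *\<^sub>R w i) = (\<lambda>f. \<Sum>i\<in>I. c i * chart_tvec U \<phi> p (w i) f)"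
proof
  fix f
  show "chart_tvec U \<phi> p (\<Sum>i\<in>I. c i *\<^sub>R w i) f = (\<Sum>i\<in>I. c i * chart_tvec U \<phi> p (w i) f)"
  proof (cases "smooth_fun \<A> f")
    case True
    then have "linear (frechet_derivative (f \<circ> inv_into U \<phi>) (at (\<phi> p)))"
      using smooth_fun_chart_differentiable assms linear_frechet_derivative by blast
    then show ?thesis using True by (simp add: chart_tvec_def linear_sum linear_scale)
  qed (simp add: chart_tvec_def)
qed

lemma tangent_space_sum:
  assumes "finite I" "\<And>i. i \<in> I \<Longrightarrow> u i \<in> tangent_space \<A> p"
  shows "(\<lambda>f. \<Sum>i\<in>I. c i * u i f) \<in> tangent_space \<A> p"
proof -
  obtain U \<phi> where U: "(U, \<phi>) \<in> \<A>" "p \<in> U" by (rule ex_chart)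
  have "\<exists>w. u i = chart_tvec U \<phi> p w" if "i \<in> I" for i
    using assms(2)[OF that] tangent_space_chart[OF U] by auto
  then obtain w where w: "\<And>i. i \<in> I \<Longrightarrow> u i = chart_tvec U \<phi> p (w i)" by metis
  then have "(\<lambda>f. \<Sum>i\<in>I. c i * u i f) = chart_tvec U \<phi> p (\<Sum>i\<in>I. c i *\<^sub>R w i)"
    unfolding chart_tvec_lincomb[OF U assms(1)] by simp
  then show ?thesis using tangent_space_chart[OF U] by simp
qed

lemma tangent_space_lincomb:
  assumes "u \<in> tangent_space \<A> p" "v \<in> tangent_space \<A> p"
  shows "(\<lambda>f. a * u f + b * v f) \<in> tangent_space \<A> p"
  using tangent_space_sum[of "{True, False}" "\<lambda>i. if i then u else v" p "\<lambda>i. if i then a else b"]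
    assms by auto

lemma tangent_space_add:
  "u \<in> tangent_space \<A> p \<Longrightarrow> v \<in> tangent_space \<A> p \<Longrightarrow> (\<lambda>f. u f + v f) \<in> tangent_space \<A> p"
  using tangent_space_lincomb[of u p v 1 1] by simp

lemma tangent_space_diff:
  "u \<in> tangent_space \<A> p \<Longrightarrow> v \<in> tangent_space \<A> p \<Longrightarrow> (\<lambda>f. u f - v f) \<in> tangent_space \<A> p"
  using tangent_space_lincomb[of u p v 1 "-1"] by simp

lemma tangent_vector_nonsmooth: "v \<in> tangent_space \<A> p \<Longrightarrow> \<not> smooth_fun \<A> f \<Longrightarrow> v f = 0"
  unfolding tangent_space_def by auto

lemma tangent_vector_add:
  assumes "v \<in> tangent_space \<A> p" "smooth_fun \<A> f" "smooth_fun \<A> h"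
  shows "v (\<lambda>x. f x + h x) = v f + v h"
proof -
  obtain U \<phi> where U: "(U, \<phi>) \<in> \<A>" "p \<in> U" by (rule ex_chart)
  obtain w where w: "v = chart_tvec U \<phi> p w" using tangent_space_chart[OF U] assms(1) by auto
  have "((\<lambda>x. (f \<circ> inv_into U \<phi>) x + (h \<circ> inv_into U \<phi>) x) has_derivative
      (\<lambda>v. frechet_derivative (f \<circ> inv_into U \<phi>) (at (\<phi> p)) v +
        frechet_derivative (h \<circ> inv_into U \<phi>) (at (\<phi> p)) v)) (at (\<phi> p))"
    by (rule has_derivative_add[OF smooth_fun_chart_has_derivative[OF assms(2) U]
          smooth_fun_chart_has_derivative[OF assms(3) U]])
  from frechet_derivative_at[OF this, symmetric] show ?thesis
    using assms smooth_add unfolding w chart_tvec_def comp_def by simp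
qed

lemma tangent_vector_const:
  assumes "v \<in> tangent_space \<A> p"
  shows "v (\<lambda>x. c) = 0"
  using assms unfolding tangent_space_def by (auto simp: comp_def)

lemma tangent_vector_scale:
  assumes "v \<in> tangent_space \<A> p" "smooth_fun \<A> f"
  shows "v (\<lambda>x. c * f x) = c * v f"
proof -
  obtain U \<phi> where U: "(U, \<phi>) \<in> \<A>" "p \<in> U" by (rule ex_chart)
  obtain w where w: "v = chart_tvec U \<phi> p w" using tangent_space_chart[OF U] assms(1) by auto
  have "((\<lambda>x. c * (f \<circ> inv_into U \<phi>) x) has_derivative
      (\<lambda>v. c * frechet_derivative (f \<circ> inv_into U \<phi>) (at (\<phi> p)) v)) (at (\<phi> p))"
    by (rule has_derivative_mult_right[OF smooth_fun_chart_has_derivative[OF assms(2) U]])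
  from frechet_derivative_at[OF this, symmetric] show ?thesis
    using assms smooth_mult[OF smooth_const] unfolding w chart_tvec_def comp_def by simp
qed

lemma tangent_vector_diff:
  assumes "v \<in> tangent_space \<A> p" "smooth_fun \<A> f" "smooth_fun \<A> h"
  shows "v (\<lambda>x. f x - h x) = v f - v h"
  using tangent_vector_add[OF assms(1,2) smooth_mult[OF smooth_const[of "-1"] assms(3)]]
    tangent_vector_scale[OF assms(1,3), of "-1"] by simp

lemma tangent_vector_sum:
  assumes "v \<in> tangent_space \<A> p" "finite I" "\<And>i. i \<in> I \<Longrightarrow> smooth_fun \<A> (f i)"
  shows "v (\<lambda>x. \<Sum>i\<in>I. c i * f i x) = (\<Sum>i\<in>I. c i * v (f i))"
  using assms(2,3)
proof (induction I rule: finite_induct)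
  case empty
  then show ?case using tangent_vector_const[OF assms(1)] by simp
next
  case (insert i I)
  have "v (\<lambda>x. c i * f i x + (\<Sum>i\<in>I. c i * f i x)) =
      v (\<lambda>x. c i * f i x) + v (\<lambda>x. \<Sum>i\<in>I. c i * f i x)"
    using insert by (intro tangent_vector_add[OF assms(1)] smooth_sum smooth_mult smooth_const) auto
  then show ?case using insert tangent_vector_scale[OF assms(1)] by simp
qed

section \<open>Vector fields\<close>

lemma vector_field_tangent: "vector_field \<A> X \<Longrightarrow> X p \<in> tangent_space \<A> p"
  unfolding vector_field_def by blast

text \<open>Tangent vectors vanish on functions that are not smooth, so \<open>f\<close> is
  arbitrary. Identities between fields can then be proved as equalities of functionals without a
  case distinction on \<open>f\<close>.\<close>

lemma vector_field_smooth:
  assumes "vector_field \<A> X"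
  shows "smooth_fun \<A> (\<lambda>p. X p f)"
proof (cases "smooth_fun \<A> f")
  case False
  then have "(\<lambda>p. X p f) = (\<lambda>p. 0)"
    using assms tangent_vector_nonsmooth vector_field_tangent by blast
  then show ?thesis using smooth_const by simp
qed (use assms vector_field_def in blast)

lemma vector_field_sum:
  assumes "finite I" "\<And>i. i \<in> I \<Longrightarrow> vector_field \<A> (X i)" "\<And>i. i \<in> I \<Longrightarrow> smooth_fun \<A> (a i)"
  shows "vector_field \<A> (\<lambda>p f. \<Sum>i\<in>I. a i p * X i p f)"
  using assms unfolding vector_field_def
  by (auto intro!: tangent_space_sum smooth_sum smooth_mult)

lemma vector_field_mult: "smooth_fun \<A> h \<Longrightarrow> vector_field \<A> X \<Longrightarrow> vector_field \<A> (vf_mult h X)"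
  using vector_field_sum[of "{()}" "\<lambda>_. X" "\<lambda>_. h"] by (simp add: vf_mult_def)

lemma vector_field_diff: "vector_field \<A> X \<Longrightarrow> vector_field \<A> Y \<Longrightarrow> vector_field \<A> (vf_diff X Y)"
  unfolding vector_field_def vf_diff_def by (auto intro!: tangent_space_diff smooth_diff)

lemma lie_bracket_antisym: "lie_bracket X Y p f = - lie_bracket Y X p f"
  by (simp add: lie_bracket_def)

lemma lie_bracket_sum:
  assumes "finite I" "\<And>i. i \<in> I \<Longrightarrow> vector_field \<A> (Z i)" "vector_field \<A> E"
  shows "lie_bracket E (\<lambda>p f. \<Sum>i\<in>I. c i * Z i p f) = (\<lambda>p f. \<Sum>i\<in>I. c i * lie_bracket E (Z i) p f)"
proof (intro ext)
  fix p f
  have "E p (\<lambda>q. \<Sum>i\<in>I. c i * Z i q f) = (\<Sum>i\<in>I. c i * E p (\<lambda>q. Z i q f))"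
    using assms vector_field_tangent[of E] vector_field_smooth by (intro tangent_vector_sum) blast+
  then show "lie_bracket E (\<lambda>p f. \<Sum>i\<in>I. c i * Z i p f) p f = (\<Sum>i\<in>I. c i * lie_bracket E (Z i) p f)"
    by (simp add: lie_bracket_def sum_subtractf right_diff_distrib)
qed

text \<open>Additivity of tangent vectors expands the nested brackets into threefold derivatives,
  which cancel. The argument does not presuppose that a bracket is itself a vector field.\<close>

lemma lie_bracket_jacobi:
  assumes "vector_field \<A> E" "vector_field \<A> F" "vector_field \<A> Z"
  shows "lie_bracket (lie_bracket E F) Z p f =
    lie_bracket E (lie_bracket F Z) p f - lie_bracket F (lie_bracket E Z) p f"
proof -
  have "U p (\<lambda>q. V q (\<lambda>q. W q f) - W q (\<lambda>q. V q f)) =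
      U p (\<lambda>q. V q (\<lambda>q. W q f)) - U p (\<lambda>q. W q (\<lambda>q. V q f))"
    if "vector_field \<A> U" "vector_field \<A> V" "vector_field \<A> W" for U V W
    using vector_field_tangent[OF that(1)] vector_field_smooth that
    by (intro tangent_vector_diff) blast+
  from this[of E F Z] this[of F E Z] this[of Z E F] show ?thesis
    using assms by (simp add: lie_bracket_def)
qed

end

section \<open>Riemannian metrics\<close>

locale levi_civita_manifold = smooth_manifold \<A>
  for \<A> :: "('g::{t2_space,second_countable_topology}, 'e::euclidean_space) atlas" +
  fixes g :: "'g metric" and D :: "'g connection"
  assumes metric: "riemannian_metric \<A> g" and levi_civita: "levi_civita \<A> g D"
begin

lemma metric_sym: "u \<in> tangent_space \<A> p \<Longrightarrow> v \<in> tangent_space \<A> p \<Longrightarrow> g p u v = g p v u"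
  using metric unfolding riemannian_metric_def by blast

lemma metric_lincomb_left:
  "u \<in> tangent_space \<A> p \<Longrightarrow> v \<in> tangent_space \<A> p \<Longrightarrow> w \<in> tangent_space \<A> p \<Longrightarrow>
    g p (\<lambda>f. a * u f + b * v f) w = a * g p u w + b * g p v w"
  using metric unfolding riemannian_metric_def by blast

lemma metric_smooth:
  "vector_field \<A> X \<Longrightarrow> vector_field \<A> Y \<Longrightarrow> smooth_fun \<A> (\<lambda>p. g p (X p) (Y p))"
  using metric unfolding riemannian_metric_def by blast

lemma metric_add_left:
  "u \<in> tangent_space \<A> p \<Longrightarrow> v \<in> tangent_space \<A> p \<Longrightarrow> w \<in> tangent_space \<A> p \<Longrightarrow>
    g p (\<lambda>f. u f + v f) w = g p u w + g p v w"
  using metric_lincomb_left[of u p v w 1 1] by simp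

lemma metric_diff_left:
  "u \<in> tangent_space \<A> p \<Longrightarrow> v \<in> tangent_space \<A> p \<Longrightarrow> w \<in> tangent_space \<A> p \<Longrightarrow>
    g p (\<lambda>f. u f - v f) w = g p u w - g p v w"
  using metric_lincomb_left[of u p v w 1 "-1"] by simp

lemma metric_sum_left:
  assumes "finite I" "\<And>i. i \<in> I \<Longrightarrow> u i \<in> tangent_space \<A> p" "w \<in> tangent_space \<A> p"
  shows "g p (\<lambda>f. \<Sum>i\<in>I. c i * u i f) w = (\<Sum>i\<in>I. c i * g p (u i) w)"
  using assms(1,2)
proof (induction I rule: finite_induct)
  case empty
  then show ?case using metric_lincomb_left[OF assms(3,3,3), of 0 0] by simp
next
  case (insert i I)
  have "g p (\<lambda>f. c i * u i f + 1 * (\<Sum>i\<in>I. c i * u i f)) w =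
      c i * g p (u i) w + 1 * g p (\<lambda>f. \<Sum>i\<in>I. c i * u i f) w"
    using insert assms(3) by (intro metric_lincomb_left tangent_space_sum) auto
  then show ?case using insert by simp
qed

lemma metric_sum_right:
  assumes "finite I" "\<And>i. i \<in> I \<Longrightarrow> u i \<in> tangent_space \<A> p" "w \<in> tangent_space \<A> p"
  shows "g p w (\<lambda>f. \<Sum>i\<in>I. c i * u i f) = (\<Sum>i\<in>I. c i * g p w (u i))"
proof -
  have "g p w (\<lambda>f. \<Sum>i\<in>I. c i * u i f) = g p (\<lambda>f. \<Sum>i\<in>I. c i * u i f) w"
    by (intro metric_sym assms tangent_space_sum)
  also have "\<dots> = (\<Sum>i\<in>I. c i * g p (u i) w)" by (intro metric_sum_left assms)
  also have "\<dots> = (\<Sum>i\<in>I. c i * g p w (u i))"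
    using assms metric_sym by (intro sum.cong) auto
  finally show ?thesis .
qed

lemma orthonormal_coeff:
  assumes "finite I" "\<And>i. i \<in> I \<Longrightarrow> u i \<in> tangent_space \<A> p"
    and "\<And>i j. i \<in> I \<Longrightarrow> j \<in> I \<Longrightarrow> g p (u i) (u j) = of_bool (i = j)" and "j \<in> I"
  shows "g p (\<lambda>f. \<Sum>i\<in>I. c i * u i f) (u j) = c j"
proof -
  have "g p (\<lambda>f. \<Sum>i\<in>I. c i * u i f) (u j) = (\<Sum>i\<in>I. c i * g p (u i) (u j))"
    using assms by (intro metric_sum_left) auto
  also have "\<dots> = (\<Sum>i\<in>I. if i = j then c i else 0)"
    using assms by (intro sum.cong) auto
  finally show ?thesis using assms by simp
qed

text \<open>The tangent space is the image of the model space under a linear map, and the preimages of an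
  orthonormal family are linearly independent.\<close>

lemma orthonormal_expansion:
  assumes e: "\<And>i. i < DIM('e) \<Longrightarrow> e i \<in> tangent_space \<A> p"
    and on: "\<And>i j. i < DIM('e) \<Longrightarrow> j < DIM('e) \<Longrightarrow> g p (e i) (e j) = of_bool (i = j)"
    and v: "v \<in> tangent_space \<A> p"
  shows "v = (\<lambda>f. \<Sum>i<DIM('e). g p v (e i) * e i f)"
proof -
  let ?I = "{..<DIM('e)}"
  obtain U \<phi> where U: "(U, \<phi>) \<in> \<A>" "p \<in> U" by (rule ex_chart)
  have "\<exists>w. e i = chart_tvec U \<phi> p w" if "i \<in> ?I" for i
    using e that tangent_space_chart[OF U] by auto
  then obtain w where w: "\<And>i. i \<in> ?I \<Longrightarrow> e i = chart_tvec U \<phi> p (w i)" by metis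
  have sum: "chart_tvec U \<phi> p (\<Sum>i\<in>?I. c i *\<^sub>R w i) = (\<lambda>f. \<Sum>i\<in>?I. c i * e i f)" for c
    using chart_tvec_lincomb[OF U, of ?I c w] w by simp
  have coeff: "g p (\<lambda>f. \<Sum>i\<in>?I. c i * e i f) (e j) = c j" if "j \<in> ?I" for c j
    using e on that by (intro orthonormal_coeff) auto
  have inj: "inj_on w ?I"
  proof
    fix i j assume ij: "i \<in> ?I" "j \<in> ?I" "w i = w j"
    then have "g p (e i) (e j) = g p (e j) (e j)" using w by metis
    then show "i = j" using ij on by (auto split: if_splits)
  qed
  have "independent (w ` ?I)"
  proof (rule independent_if_scalars_zero)
    fix c x assume *: "(\<Sum>x\<in>w ` ?I. c x *\<^sub>R x) = 0" and "x \<in> w ` ?I"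
    then obtain j where j: "j \<in> ?I" "x = w j" by auto
    have "(\<Sum>i\<in>?I. c (w i) *\<^sub>R w i) = 0" using * by (simp add: sum.reindex[OF inj])
    then have "(\<lambda>f. \<Sum>i\<in>?I. c (w i) * e i f) = (\<lambda>f. \<Sum>i\<in>?I. 0 * e i f)"
      using sum[of "\<lambda>i. c (w i)"] sum[of "\<lambda>i. 0"] by simp
    then show "c x = 0" using coeff[OF j(1), of "\<lambda>i. c (w i)"] coeff[OF j(1), of "\<lambda>i. 0"] j(2)
      by simp
  qed simp
  \<comment> \<open>Independent vectors as many as the dimension span the model space, so
    \<open>v\<close> has coordinates in the family; pairing with \<open>e i\<close> identifies
    them.\<close>
  moreover have "dim (UNIV :: 'e set) \<le> card (w ` ?I)" by (simp add: card_image[OF inj])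
  ultimately have span: "UNIV \<subseteq> span (w ` ?I)" by (intro card_ge_dim_independent) auto
  obtain x where x: "v = chart_tvec U \<phi> p x" using tangent_space_chart[OF U] v by auto
  have "x \<in> range (\<lambda>c. \<Sum>y\<in>w ` ?I. c y *\<^sub>R y)" using span by (auto simp: span_finite)
  then obtain c where "x = (\<Sum>y\<in>w ` ?I. c y *\<^sub>R y)" by auto
  then have "x = (\<Sum>i\<in>?I. c (w i) *\<^sub>R w i)" by (simp add: sum.reindex[OF inj])
  then have veq: "v = (\<lambda>f. \<Sum>i\<in>?I. c (w i) * e i f)" using x sum by simp
  then have "g p v (e i) = c (w i)" if "i \<in> ?I" for i using coeff[OF that] by simp
  then show ?thesis using veq by simp
qed

text \<open>This evaluates the definite description in the projection: the Fourier sum has the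
  defining property, and testing any other candidate against each \<open>u i\<close> forces the same
  coefficients.\<close>

lemma orthogonal_projection_orthonormal:
  assumes I: "finite I" and u: "\<And>i. i \<in> I \<Longrightarrow> u i \<in> tangent_space \<A> p"
    and on: "\<And>i j. i \<in> I \<Longrightarrow> j \<in> I \<Longrightarrow> g p (u i) (u j) = of_bool (i = j)"
    and W: "W p = {(\<lambda>f. \<Sum>i\<in>I. c i * u i f) | c. True}"
    and v: "v \<in> tangent_space \<A> p"
  shows "orthogonal_projection g W p v = (\<lambda>f. \<Sum>i\<in>I. g p v (u i) * u i f)"
  unfolding orthogonal_projection_def
proof (rule the_equality)
  let ?P = "\<lambda>f. \<Sum>i\<in>I. g p v (u i) * u i f"
  have T: "(\<lambda>f. \<Sum>i\<in>I. c i * u i f) \<in> tangent_space \<A> p" for c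
    using I u by (rule tangent_space_sum)
  have "g p (\<lambda>f. v f - ?P f) (\<lambda>f. \<Sum>i\<in>I. c i * u i f) = 0" for c
  proof -
    have "g p (\<lambda>f. v f - ?P f) (u i) = 0" if "i \<in> I" for i
      using metric_diff_left[OF v T u] orthonormal_coeff[OF I u on] that by simp
    moreover have "g p (\<lambda>f. v f - ?P f) (\<lambda>f. \<Sum>i\<in>I. c i * u i f) =
        (\<Sum>i\<in>I. c i * g p (\<lambda>f. v f - ?P f) (u i))"
      using I u by (intro metric_sum_right tangent_space_diff v T)
    ultimately show ?thesis by simp
  qed
  then show "?P \<in> W p \<and> (\<forall>w\<in>W p. g p (\<lambda>f. v f - ?P f) w = 0)"
    unfolding W by auto
next
  fix y assume y: "y \<in> W p \<and> (\<forall>w\<in>W p. g p (\<lambda>f. v f - y f) w = 0)"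
  then obtain c where c: "y = (\<lambda>f. \<Sum>i\<in>I. c i * u i f)" unfolding W by auto
  have yT: "y \<in> tangent_space \<A> p" unfolding c using I u by (rule tangent_space_sum)
  have "c i = g p v (u i)" if i: "i \<in> I" for i
  proof -
    have "(\<lambda>f. \<Sum>j\<in>I. of_bool (j = i) * u j f) = u i"
      using I i by (auto simp: of_bool_def if_distrib[of "\<lambda>x. x * _"] cong: if_cong)
    then have "u i \<in> W p" unfolding W
      by (intro CollectI exI[of _ "\<lambda>j. of_bool (j = i)"]) simp
    then have "g p v (u i) = g p y (u i)" using y metric_diff_left[OF v yT u[OF i]] by simp
    then show ?thesis unfolding c using orthonormal_coeff[OF I u on i] by simp
  qed
  then show "y = (\<lambda>f. \<Sum>i\<in>I. g p v (u i) * u i f)" unfolding c by simp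
qed

section \<open>The Levi-Civita connection\<close>

lemma connection_vector_field: "vector_field \<A> X \<Longrightarrow> vector_field \<A> Y \<Longrightarrow> vector_field \<A> (D X Y)"
  using levi_civita unfolding levi_civita_def affine_connection_def by blast

lemma torsion_free:
  "vector_field \<A> X \<Longrightarrow> vector_field \<A> Y \<Longrightarrow> vf_diff (D X Y) (D Y X) = lie_bracket X Y"
  using levi_civita unfolding levi_civita_def by blast

lemma metric_compatible:
  "vector_field \<A> X \<Longrightarrow> vector_field \<A> Y \<Longrightarrow> vector_field \<A> Z \<Longrightarrow>
    X p (\<lambda>q. g q (Y q) (Z q)) = g p (D X Y p) (Z p) + g p (Y p) (D X Z p)"
  using levi_civita unfolding levi_civita_def by blast

text \<open>Torsion-freeness writes the bracket as a difference of two covariant derivatives, which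
  are vector fields. This replaces the cancellation of second-order terms in a chart.\<close>

lemma lie_bracket_vector_field:
  "vector_field \<A> X \<Longrightarrow> vector_field \<A> Y \<Longrightarrow> vector_field \<A> (lie_bracket X Y)"
  using torsion_free vector_field_diff connection_vector_field by metis

lemma connection_sum_left:
  assumes "finite I" "\<And>i. i \<in> I \<Longrightarrow> vector_field \<A> (E i)" "\<And>i. i \<in> I \<Longrightarrow> smooth_fun \<A> (a i)"
    and Z: "vector_field \<A> Z"
  shows "D (\<lambda>p f. \<Sum>i\<in>I. a i p * E i p f) Z = (\<lambda>p f. \<Sum>i\<in>I. a i p * D (E i) Z p f)"
proof -
  have mult: "D (vf_mult h X) Z = vf_mult h (D X Z)" if "smooth_fun \<A> h" "vector_field \<A> X" for h X
    using levi_civita Z that unfolding levi_civita_def affine_connection_def by blast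
  have add: "D (vf_add X Y) Z = vf_add (D X Z) (D Y Z)"
    if "vector_field \<A> X" "vector_field \<A> Y" for X Y
    using levi_civita Z that unfolding levi_civita_def affine_connection_def by blast
  show ?thesis
    using assms(1-3)
  proof (induction I rule: finite_induct)
    case empty
    \<comment> \<open>The empty sum is the zero field, that is, the function \<open>0\<close> times
      \<open>Z\<close>.\<close>
    then show ?case using mult[OF smooth_const[of 0] Z] by (simp add: vf_mult_def)
  next
    case (insert i I)
    have "D (vf_add (vf_mult (a i) (E i)) (\<lambda>p f. \<Sum>i\<in>I. a i p * E i p f)) Z =
        vf_add (D (vf_mult (a i) (E i)) Z) (D (\<lambda>p f. \<Sum>i\<in>I. a i p * E i p f) Z)"
      using insert by (intro add vector_field_mult vector_field_sum) auto
    then show ?case using insert mult by (simp add: vf_add_def vf_mult_def)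
  qed
qed

end

section \<open>Left-invariant fields\<close>

locale left_invariant_levi_civita = levi_civita_manifold \<A> g D
  for \<A> :: "('g::{t2_space,second_countable_topology}, 'e::euclidean_space) atlas" and g D +
  fixes G :: "'g monoid"
  assumes lie_group: "lie_group G \<A>" and left_invariant: "left_invariant_metric G \<A> g"
begin

lemma lie_algebra_vector_field: "X \<in> lie_algebra G \<A> \<Longrightarrow> vector_field \<A> X"
  by (simp add: lie_algebra_def)

lemma lie_algebra_push: "X \<in> lie_algebra G \<A> \<Longrightarrow> X (a \<otimes>\<^bsub>G\<^esub> p) = left_push G \<A> a (X p)"
  by (simp add: lie_algebra_def)

text \<open>Left translation by \<open>p\<close> is an isometry that takes the identity to
  \<open>p\<close> and maps left-invariant fields to themselves.\<close>

lemma metric_lie_algebra: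
  assumes "X \<in> lie_algebra G \<A>" "Y \<in> lie_algebra G \<A>"
  shows "g p (X p) (Y p) = lie_inner G g X Y"
proof -
  interpret group G using lie_group by (simp add: lie_group_def)
  have p: "p \<otimes>\<^bsub>G\<^esub> \<one>\<^bsub>G\<^esub> = p" using lie_group by (simp add: lie_group_def)
  have "g (p \<otimes>\<^bsub>G\<^esub> \<one>\<^bsub>G\<^esub>) (left_push G \<A> p (X \<one>\<^bsub>G\<^esub>)) (left_push G \<A> p (Y \<one>\<^bsub>G\<^esub>)) =
      lie_inner G g X Y"
    using left_invariant assms lie_algebra_vector_field vector_field_tangent
    unfolding left_invariant_metric_def lie_inner_def by blast
  then show ?thesis
    using lie_algebra_push[OF assms(1), of p "\<one>\<^bsub>G\<^esub>"] lie_algebra_push[OF assms(2), of p "\<one>\<^bsub>G\<^esub>"] p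
    by simp
qed

lemma lie_algebra_bracket:
  assumes X: "X \<in> lie_algebra G \<A>" and Y: "Y \<in> lie_algebra G \<A>"
  shows "lie_bracket X Y \<in> lie_algebra G \<A>"
proof -
  have vf: "vector_field \<A> (lie_bracket X Y)"
    using assms by (intro lie_bracket_vector_field lie_algebra_vector_field)
  have "lie_bracket X Y (a \<otimes>\<^bsub>G\<^esub> p) f = left_push G \<A> a (lie_bracket X Y p) f" for a p f
  proof (cases "smooth_fun \<A> f")
    case True
    \<comment> \<open>Left invariance enters twice: for \<open>U\<close> at the point
      \<open>p\<close>, and for \<open>W\<close> at every \<open>q\<close>, to rewrite the function
      that \<open>U\<close> differentiates.\<close>
    have "U (a \<otimes>\<^bsub>G\<^esub> p) (\<lambda>q. W q f) = U p (\<lambda>q. W q (\<lambda>x. f (a \<otimes>\<^bsub>G\<^esub> x)))"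
      if "U \<in> lie_algebra G \<A>" "W \<in> lie_algebra G \<A>" for U W
      using that True vector_field_smooth[OF lie_algebra_vector_field, of W f]
      by (simp add: lie_algebra_push left_push_def)
    from this[OF X Y] this[OF Y X] show ?thesis using True
      by (simp add: lie_bracket_def left_push_def)
  next
    case False
    then show ?thesis
      using tangent_vector_nonsmooth vector_field_tangent[OF vf] by (auto simp: left_push_def)
  qed
  then show ?thesis using vf unfolding lie_algebra_def by blast
qed

text \<open>Koszul's formula, symmetrised; the derivatives of the inner products vanish since these are
  constant.\<close>

lemma koszul_symmetrised:
  assumes U: "U \<in> lie_algebra G \<A>" and V: "V \<in> lie_algebra G \<A>" and W: "W \<in> lie_algebra G \<A>"
  shows "g p (D U V p) (W p) + g p (D V U p) (W p) =
    lie_inner G g (lie_bracket W U) V + lie_inner G g (lie_bracket W V) U"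
proof -
  have vf: "vector_field \<A> U" "vector_field \<A> V" "vector_field \<A> W"
    using assms lie_algebra_vector_field by auto
  have T: "X p \<in> tangent_space \<A> p" "D X Y p \<in> tangent_space \<A> p"
    if "vector_field \<A> X" "vector_field \<A> Y" for X Y
    using that connection_vector_field vector_field_tangent by auto
  \<comment> \<open>The inner product of \<open>Y\<close> and \<open>Z\<close> is constant, so
    metric compatibility makes the covariant derivative along \<open>X\<close> skew.\<close>
  have skew: "g p (D X Y p) (Z p) = - g p (D X Z p) (Y p)"
    if "X \<in> {U, V, W}" "Y \<in> {U, V, W}" "Z \<in> {U, V, W}" for X Y Z
  proof -
    have L: "X \<in> lie_algebra G \<A>" "Y \<in> lie_algebra G \<A>" "Z \<in> lie_algebra G \<A>"
      using that assms by auto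
    note v = L[THEN lie_algebra_vector_field]
    have "X p (\<lambda>q. g q (Y q) (Z q)) = 0"
      using L v by (simp add: metric_lie_algebra tangent_vector_const[OF T(1)])
    then show ?thesis
      using metric_compatible[OF v, of p] metric_sym[OF T(1)[OF v(2) v(2)] T(2)[OF v(1) v(3)]] by simp
  qed
  have bracket: "lie_inner G g (lie_bracket X Y) Z = g p (D X Y p) (Z p) - g p (D Y X p) (Z p)"
    if "X \<in> {U, V, W}" "Y \<in> {U, V, W}" "Z \<in> {U, V, W}" for X Y Z
  proof -
    have L: "X \<in> lie_algebra G \<A>" "Y \<in> lie_algebra G \<A>" "Z \<in> lie_algebra G \<A>"
      using that assms by auto
    note v = L[THEN lie_algebra_vector_field]
    have "lie_inner G g (lie_bracket X Y) Z = g p (lie_bracket X Y p) (Z p)"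
      using L by (simp add: metric_lie_algebra lie_algebra_bracket)
    also have "lie_bracket X Y p = (\<lambda>f. D X Y p f - D Y X p f)"
      by (simp add: torsion_free[OF v(1,2), symmetric] vf_diff_def)
    finally show ?thesis using v T by (simp add: metric_diff_left)
  qed
  \<comment> \<open>Expanding both brackets, the two derivatives along \<open>W\<close> cancel by
    skewness; in the other two terms skewness moves \<open>W\<close> out of the differentiated
    slot.\<close>
  show ?thesis
    using bracket[of W U V] bracket[of W V U] skew[of U V W] skew[of V U W] skew[of W U V] by simp
qed

end

section \<open>Foliations by left cosets in an orthonormal frame\<close>

text \<open>The vertical fields come first in the frame, so that vertical and horizontal become the
  index ranges \<open>{..<m}\<close> and \<open>{m..<DIM('e)}\<close>.\<close>

locale left_invariant_foliation = left_invariant_levi_civita \<A> g D G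
  for \<A> :: "('g::{t2_space,second_countable_topology}, 'e::euclidean_space) atlas" and g D G +
  fixes e :: "nat \<Rightarrow> 'g vfield" and m :: nat and V :: "'g distribution"
  assumes frame: "\<And>i. i < DIM('e) \<Longrightarrow> e i \<in> lie_algebra G \<A>"
    and orthonormal:
      "\<And>i j. i < DIM('e) \<Longrightarrow> j < DIM('e) \<Longrightarrow> lie_inner G g (e i) (e j) = of_bool (i = j)"
    and m_le: "m \<le> DIM('e)"
    and V: "\<And>p. V p = {(\<lambda>f. \<Sum>i<m. c i * e i p f) | c. True}"
begin

abbreviation H :: "'g distribution" where
  "H \<equiv> orthogonal_distribution \<A> g V"

definition sc :: "nat \<Rightarrow> nat \<Rightarrow> nat \<Rightarrow> real" where
  "sc i j k = lie_inner G g (lie_bracket (e i) (e j)) (e k)"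

lemma frame_vector_field: "i < DIM('e) \<Longrightarrow> vector_field \<A> (e i)"
  using frame lie_algebra_vector_field by blast

lemma frame_tangent: "i < DIM('e) \<Longrightarrow> e i p \<in> tangent_space \<A> p"
  using frame_vector_field vector_field_tangent by blast

lemma frame_orthonormal:
  "i < DIM('e) \<Longrightarrow> j < DIM('e) \<Longrightarrow> g p (e i p) (e j p) = of_bool (i = j)"
  using frame orthonormal by (simp add: metric_lie_algebra)

lemma frame_expansion:
  "v \<in> tangent_space \<A> p \<Longrightarrow> v = (\<lambda>f. \<Sum>i<DIM('e). g p v (e i p) * e i p f)"
  by (rule orthonormal_expansion[OF frame_tangent frame_orthonormal])

lemma sc_antisym:
  assumes "i < DIM('e)" "j < DIM('e)" "k < DIM('e)"
  shows "sc i j k = - sc j i k"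
proof -
  have "lie_bracket (e i) (e j) \<one>\<^bsub>G\<^esub> = (\<lambda>f. \<Sum>x\<in>{()}. -1 * lie_bracket (e j) (e i) \<one>\<^bsub>G\<^esub> f)"
    using lie_bracket_antisym[of "e i" "e j"] by auto
  moreover have "g \<one>\<^bsub>G\<^esub> (\<lambda>f. \<Sum>x\<in>{()}. -1 * lie_bracket (e j) (e i) \<one>\<^bsub>G\<^esub> f) (e k \<one>\<^bsub>G\<^esub>) =
      (\<Sum>x\<in>{()}. -1 * g \<one>\<^bsub>G\<^esub> (lie_bracket (e j) (e i) \<one>\<^bsub>G\<^esub>) (e k \<one>\<^bsub>G\<^esub>))"
    using assms frame_vector_field
    by (intro metric_sum_left frame_tangent vector_field_tangent lie_bracket_vector_field) auto
  ultimately show ?thesis by (simp add: sc_def lie_inner_def)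
qed

lemma sc_eqI:
  assumes ij: "i < DIM('e)" "j < DIM('e)" and kl: "k < DIM('e)" "l < DIM('e)"
    and eq: "lie_bracket (e i) (e j) = vf_scale c (e l)"
  shows "sc i j k = c * of_bool (k = l)"
proof -
  have "lie_bracket (e i) (e j) \<one>\<^bsub>G\<^esub> = (\<lambda>f. c * e l \<one>\<^bsub>G\<^esub> f + 0 * e l \<one>\<^bsub>G\<^esub> f)"
    by (simp add: eq vf_mult_def)
  then show ?thesis
    unfolding sc_def lie_inner_def using kl
    by (simp only:) (subst metric_lincomb_left; simp add: frame_tangent frame_orthonormal eq_commute)
qed

lemma sc_eq_0I:
  assumes "i < DIM('e)" "j < DIM('e)" "k < DIM('e)" "lie_bracket (e i) (e j) = vf_zero"
  shows "sc i j k = 0"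
  using sc_eqI[of i j k k 0] assms by (simp add: vf_mult_def)

lemma lie_algebra_expansion:
  assumes "Z \<in> lie_algebra G \<A>"
  shows "Z = (\<lambda>p f. \<Sum>i<DIM('e). lie_inner G g Z (e i) * e i p f)"
proof
  fix p
  show "Z p = (\<lambda>f. \<Sum>i<DIM('e). lie_inner G g Z (e i) * e i p f)"
    using frame_expansion[OF vector_field_tangent[OF lie_algebra_vector_field[OF assms]], of p]
      metric_lie_algebra[OF assms frame, of _ p] by simp
qed

lemma inner_bracket_frame:
  assumes "i < DIM('e)" "k < DIM('e)" "Z \<in> lie_algebra G \<A>"
  shows "lie_inner G g (lie_bracket (e i) Z) (e k) = (\<Sum>l<DIM('e). lie_inner G g Z (e l) * sc i l k)"
proof -
  have "lie_bracket (e i) Z = (\<lambda>p f. \<Sum>l<DIM('e). lie_inner G g Z (e l) * lie_bracket (e i) (e l) p f)"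
    by (subst (1) lie_algebra_expansion[OF assms(3)])
      (intro lie_bracket_sum frame_vector_field assms, auto)
  moreover have "g \<one>\<^bsub>G\<^esub> (\<lambda>f. \<Sum>l<DIM('e). lie_inner G g Z (e l) * lie_bracket (e i) (e l) \<one>\<^bsub>G\<^esub> f)
      (e k \<one>\<^bsub>G\<^esub>) = (\<Sum>l<DIM('e). lie_inner G g Z (e l) * g \<one>\<^bsub>G\<^esub> (lie_bracket (e i) (e l) \<one>\<^bsub>G\<^esub>) (e k \<one>\<^bsub>G\<^esub>))"
    using assms frame_vector_field
    by (intro metric_sum_left frame_tangent vector_field_tangent lie_bracket_vector_field) auto
  ultimately show ?thesis by (simp add: sc_def lie_inner_def)
qed

lemma sc_jacobi:
  assumes ijk: "i < DIM('e)" "j < DIM('e)" "k < DIM('e)" and q: "q < DIM('e)"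
  shows "(\<Sum>l<DIM('e). sc i j l * sc l k q) =
    (\<Sum>l<DIM('e). sc j k l * sc i l q) - (\<Sum>l<DIM('e). sc i k l * sc j l q)"
proof -
  note e = ijk[THEN frame] and v = ijk[THEN frame_vector_field]
  let ?B = lie_bracket and ?o = "\<one>\<^bsub>G\<^esub>"
  have T: "?B X Y p \<in> tangent_space \<A> p" if "vector_field \<A> X" "vector_field \<A> Y" for X Y p
    using that lie_bracket_vector_field vector_field_tangent by blast
  \<comment> \<open>\<open>inner_bracket_frame\<close> expands the second argument of a bracket, so
    the inner bracket is moved there at the cost of a sign; antisymmetry of \<open>sc\<close> undoes
    the sign below.\<close>
  have "?B (?B (e i) (e j)) (e k) ?o = (\<lambda>f. - 1 * ?B (e k) (?B (e i) (e j)) ?o f + 0 * e k ?o f)"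
    using lie_bracket_antisym[of "?B (e i) (e j)"] by auto
  then have "lie_inner G g (?B (?B (e i) (e j)) (e k)) (e q) =
      - lie_inner G g (?B (e k) (?B (e i) (e j))) (e q)"
    unfolding lie_inner_def using v q
    by (simp only:) (subst metric_lincomb_left;
      auto intro!: T frame_tangent frame_vector_field lie_bracket_vector_field ijk)
  moreover have "?B (?B (e i) (e j)) (e k) ?o =
      (\<lambda>f. ?B (e i) (?B (e j) (e k)) ?o f - ?B (e j) (?B (e i) (e k)) ?o f)"
    using lie_bracket_jacobi[OF v] by blast
  then have "lie_inner G g (?B (?B (e i) (e j)) (e k)) (e q) =
      lie_inner G g (?B (e i) (?B (e j) (e k))) (e q) - lie_inner G g (?B (e j) (?B (e i) (e k))) (e q)"
    unfolding lie_inner_def using v q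
    by (simp only:) (subst metric_diff_left; auto intro!: T frame_tangent lie_bracket_vector_field)
  moreover have "lie_inner G g (?B (e a) (?B (e b) (e c))) (e q) = (\<Sum>l<DIM('e). sc b c l * sc a l q)"
    if "a < DIM('e)" "b < DIM('e)" "c < DIM('e)" for a b c
    using inner_bracket_frame[OF that(1) q lie_algebra_bracket[OF frame frame]] that
    by (simp add: sc_def)
  moreover have "(\<Sum>l<DIM('e). sc i j l * sc k l q) = - (\<Sum>l<DIM('e). sc i j l * sc l k q)"
    using sc_antisym[of k _ q] ijk q by (simp add: sum_negf[symmetric])
  ultimately show ?thesis using ijk by simp
qed

section \<open>Vertical and horizontal spaces in the frame\<close>

lemma tangent_H: "v \<in> H p \<Longrightarrow> v \<in> tangent_space \<A> p"
  by (simp add: orthogonal_distribution_def)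

lemma tangent_V: "v \<in> V p \<Longrightarrow> v \<in> tangent_space \<A> p"
  using m_le unfolding V by (auto intro!: tangent_space_sum frame_tangent)

lemma frame_in_V: "i < m \<Longrightarrow> e i p \<in> V p"
  unfolding V by (intro CollectI exI[of _ "\<lambda>j. of_bool (j = i)"])
    (auto simp: of_bool_def if_distrib[of "\<lambda>x. x * _"] cong: if_cong)

lemma V_expansion:
  assumes "v \<in> V p"
  shows "v = (\<lambda>f. \<Sum>i<m. g p v (e i p) * e i p f)"
proof -
  obtain c where c: "v = (\<lambda>f. \<Sum>i<m. c i * e i p f)" using assms V by auto
  have "g p v (e i p) = c i" if "i < m" for i
    unfolding c using m_le that by (intro orthonormal_coeff) (auto simp: frame_tangent frame_orthonormal)
  then show ?thesis using c by simp
qed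

lemma metric_V_H: "u \<in> V p \<Longrightarrow> v \<in> H p \<Longrightarrow> g p u v = 0"
  using metric_sym[OF tangent_V tangent_H] by (auto simp: orthogonal_distribution_def)

lemma H: "H p = {(\<lambda>f. \<Sum>i\<in>{m..<DIM('e)}. c i * e i p f) | c. True}"
proof (intro equalityI subsetI)
  fix v assume v: "v \<in> H p"
  have 0: "g p v (e i p) = 0" if "i < m" for i
    using v frame_in_V[OF that] by (simp add: orthogonal_distribution_def)
  have "(\<Sum>i<DIM('e). g p v (e i p) * e i p f) = (\<Sum>i\<in>{m..<DIM('e)}. g p v (e i p) * e i p f)" for f
    using 0 by (intro sum.mono_neutral_right) auto
  then show "v \<in> {(\<lambda>f. \<Sum>i\<in>{m..<DIM('e)}. c i * e i p f) | c. True}"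
    using frame_expansion[OF tangent_H[OF v]] by auto
next
  fix v assume "v \<in> {(\<lambda>f. \<Sum>i\<in>{m..<DIM('e)}. c i * e i p f) | c. True}"
  then obtain c where c: "v = (\<lambda>f. \<Sum>i\<in>{m..<DIM('e)}. c i * e i p f)" by auto
  have vT: "v \<in> tangent_space \<A> p" unfolding c by (auto intro!: tangent_space_sum frame_tangent)
  have 0: "g p v (e j p) = 0" if "j < m" for j
  proof -
    have "g p v (e j p) = (\<Sum>i\<in>{m..<DIM('e)}. c i * g p (e i p) (e j p))"
      unfolding c using that m_le by (intro metric_sum_left) (auto intro!: frame_tangent)
    then show ?thesis using that m_le by (simp add: frame_orthonormal)
  qed
  have "g p v u = 0" if u: "u \<in> V p" for u
  proof -
    obtain b where b: "u = (\<lambda>f. \<Sum>j<m. b j * e j p f)" using u unfolding V by blast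
    have "g p v u = (\<Sum>j<m. b j * g p v (e j p))"
      unfolding b using m_le vT by (intro metric_sum_right) (auto intro!: frame_tangent)
    then show ?thesis using 0 by simp
  qed
  then show "v \<in> H p" using vT by (simp add: orthogonal_distribution_def)
qed

lemma frame_in_H: "m \<le> i \<Longrightarrow> i < DIM('e) \<Longrightarrow> e i p \<in> H p"
  unfolding H by (intro CollectI exI[of _ "\<lambda>j. of_bool (j = i)"])
    (auto simp: of_bool_def if_distrib[of "\<lambda>x. x * _"] cong: if_cong)

lemma projection_V:
  "v \<in> tangent_space \<A> p \<Longrightarrow>
    orthogonal_projection g V p v = (\<lambda>f. \<Sum>i<m. g p v (e i p) * e i p f)"
  using m_le by (intro orthogonal_projection_orthonormal V)
    (auto simp: frame_tangent frame_orthonormal)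

lemma projection_H:
  "v \<in> tangent_space \<A> p \<Longrightarrow>
    orthogonal_projection g H p v = (\<lambda>f. \<Sum>i\<in>{m..<DIM('e)}. g p v (e i p) * e i p f)"
  using m_le by (intro orthogonal_projection_orthonormal H)
    (auto simp: frame_tangent frame_orthonormal)

section \<open>The second fundamental form of the leaves in terms of structure constants\<close>

lemma connection_frame_sym:
  "i < DIM('e) \<Longrightarrow> j < DIM('e) \<Longrightarrow> k < DIM('e) \<Longrightarrow>
    g p (D (e i) (e j) p) (e k p) + g p (D (e j) (e i) p) (e k p) = sc k i j + sc k j i"
  unfolding sc_def by (intro koszul_symmetrised frame)

lemma connection_tangent:
  "vector_field \<A> E \<Longrightarrow> vector_field \<A> F \<Longrightarrow> D E F p \<in> tangent_space \<A> p"
  using connection_vector_field vector_field_tangent by blast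

lemma vf_add_connection_tangent:
  "vector_field \<A> E \<Longrightarrow> vector_field \<A> F \<Longrightarrow> vf_add (D E F) (D F E) p \<in> tangent_space \<A> p"
  unfolding vf_add_def by (intro tangent_space_add connection_tangent)

text \<open>Tensoriality: \<open>g (\<nabla>\<^sub>E F, Z) = - g (F, \<nabla>\<^sub>E Z)\<close> for vertical \<open>E\<close>, \<open>F\<close> and horizontal \<open>Z\<close>,
  and the right-hand side depends only on the values of \<open>E\<close> and \<open>F\<close> at \<open>p\<close>.\<close>

lemma connection_vertical:
  assumes E: "section_of \<A> V E" and F: "section_of \<A> V F" and k: "m \<le> k" "k < DIM('e)"
  shows "g p (D E F p) (e k p) =
    (\<Sum>i<m. \<Sum>j<m. g p (E p) (e i p) * g p (F p) (e j p) * g p (D (e i) (e j) p) (e k p))"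
proof -
  have vf: "vector_field \<A> E" "vector_field \<A> F" "vector_field \<A> (e k)"
    using assms frame_vector_field unfolding section_of_def by auto
  have ve: "vector_field \<A> (e i)" if "i < m" for i using that m_le frame_vector_field by simp
  have shift: "g p (D X Y p) (e k p) = - g p (D X (e k) p) (Y p)"
    if "vector_field \<A> X" "section_of \<A> V Y" for X Y
  proof -
    have Y: "vector_field \<A> Y" "\<And>q. Y q \<in> V q" using that by (auto simp: section_of_def)
    have "(\<lambda>q. g q (Y q) (e k q)) = (\<lambda>q. 0)" using Y(2) metric_V_H frame_in_H k by blast
    then have "X p (\<lambda>q. g q (Y q) (e k q)) = 0"
      using tangent_vector_const[OF vector_field_tangent[OF that(1)]] by simp
    then show ?thesis
      using metric_compatible[OF that(1) Y(1) vf(3), of p]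
        metric_sym[OF tangent_V[OF Y(2)] connection_tangent[OF that(1) vf(3)]] by simp
  qed
  have Eexp: "E = (\<lambda>p f. \<Sum>i<m. g p (E p) (e i p) * e i p f)"
    using E V_expansion unfolding section_of_def by blast
  have Fexp: "F p = (\<lambda>f. \<Sum>j<m. g p (F p) (e j p) * e j p f)"
    using F V_expansion unfolding section_of_def by blast
  \<comment> \<open>A connection is linear over functions in its first slot, so the variable
    coefficients of \<open>E\<close> come out undifferentiated.\<close>
  have DE: "D E (e k) = (\<lambda>p f. \<Sum>i<m. g p (E p) (e i p) * D (e i) (e k) p f)"
    by (subst (1) Eexp) (intro connection_sum_left metric_smooth vf ve, auto)
  have "g p (D E F p) (e k p) = - g p (D E (e k) p) (F p)"
    by (rule shift[OF vf(1) F])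
  also have "g p (D E (e k) p) (F p) = (\<Sum>i<m. g p (E p) (e i p) * g p (D (e i) (e k) p) (F p))"
    unfolding DE using vf ve
    by (intro metric_sum_left) (auto simp: connection_tangent vector_field_tangent)
  also have "\<dots> = (\<Sum>i<m. g p (E p) (e i p) *
      (\<Sum>j<m. g p (F p) (e j p) * g p (D (e i) (e k) p) (e j p)))"
  proof (intro sum.cong refl arg_cong2[where f = "(*)"])
    fix i assume "i \<in> {..<m}"
    then show "g p (D (e i) (e k) p) (F p) =
        (\<Sum>j<m. g p (F p) (e j p) * g p (D (e i) (e k) p) (e j p))"
      by (subst (1) Fexp, intro metric_sum_right)
        (auto simp: connection_tangent vector_field_tangent frame_tangent ve vf)
  qed
  also have "- \<dots> = (\<Sum>i<m. \<Sum>j<m. g p (E p) (e i p) * g p (F p) (e j p) *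
      - g p (D (e i) (e k) p) (e j p))"
    by (simp add: sum_distrib_left sum_negf mult.assoc)
  also have "\<dots> = (\<Sum>i<m. \<Sum>j<m. g p (E p) (e i p) * g p (F p) (e j p) *
      g p (D (e i) (e j) p) (e k p))"
    using shift[OF ve] ve frame_in_V by (intro sum.cong refl) (auto simp: section_of_def)
  finally show ?thesis .
qed

lemma second_fundamental_form_V:
  assumes E: "section_of \<A> V E" and F: "section_of \<A> V F"
  shows "second_fundamental_form g D H E F p f = 1/2 * (\<Sum>k\<in>{m..<DIM('e)}.
    (\<Sum>i<m. \<Sum>j<m. g p (E p) (e i p) * g p (F p) (e j p) * (sc k i j + sc k j i)) * e k p f)"
proof -
  have vf: "vector_field \<A> E" "vector_field \<A> F" using assms by (auto simp: section_of_def)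
  have "g p (vf_add (D E F) (D F E) p) (e k p) =
      (\<Sum>i<m. \<Sum>j<m. g p (E p) (e i p) * g p (F p) (e j p) * (sc k i j + sc k j i))"
    if k: "k \<in> {m..<DIM('e)}" for k
  proof -
    have "g p (vf_add (D E F) (D F E) p) (e k p) = g p (D E F p) (e k p) + g p (D F E p) (e k p)"
      using k unfolding vf_add_def by (intro metric_add_left connection_tangent vf frame_tangent) auto
    \<comment> \<open>The summation indices are exchanged so that both double sums carry the same
      coefficients, and the frame derivatives combine into the symmetrised Koszul
      expression.\<close>
    also have "g p (D F E p) (e k p) =
      (\<Sum>j<m. \<Sum>i<m. g p (E p) (e j p) * g p (F p) (e i p) * g p (D (e i) (e j) p) (e k p))"
      using connection_vertical[OF F E, of k p] k by (subst sum.swap) (simp add: mult_ac)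
    also have "g p (D E F p) (e k p) + \<dots> =
      (\<Sum>i<m. \<Sum>j<m. g p (E p) (e i p) * g p (F p) (e j p) * 
        (g p (D (e i) (e j) p) (e k p) + g p (D (e j) (e i) p) (e k p)))"
      using connection_vertical[OF E F, of k p] k by (simp add: sum.distrib distrib_left)
    finally show ?thesis using k m_le by (simp add: connection_frame_sym)
  qed
  then show ?thesis
    unfolding second_fundamental_form_def
    using projection_H[OF vf_add_connection_tangent[OF vf], of p] by simp
qed

lemma totally_geodesic_iff:
  "totally_geodesic_foliation \<A> g D V \<longleftrightarrow>
    (\<forall>k\<in>{m..<DIM('e)}. \<forall>i<m. \<forall>j<m. sc k i j + sc k j i = 0)"
proof
  assume tg: "totally_geodesic_foliation \<A> g D V"
  show "\<forall>k\<in>{m..<DIM('e)}. \<forall>i<m. \<forall>j<m. sc k i j + sc k j i = 0"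
  proof (intro ballI allI impI)
    fix k i j assume k: "k \<in> {m..<DIM('e)}" and ij: "i < m" "j < m"
    \<comment> \<open>Any point serves, since the structure constants do not depend on it.\<close>
    fix p :: 'g
    define b where "b k = sc k i j + sc k j i" for k
    have sec: "section_of \<A> V (e i)" "section_of \<A> V (e j)"
      using ij m_le frame_in_V frame_vector_field by (auto simp: section_of_def)
    have delta: "(\<Sum>i'<m. \<Sum>j'<m. g p (e i p) (e i' p) * g p (e j p) (e j' p) * c i' j') = c i j"
      for c :: "nat \<Rightarrow> nat \<Rightarrow> real"
    proof -
      have "(\<Sum>i'<m. \<Sum>j'<m. g p (e i p) (e i' p) * g p (e j p) (e j' p) * c i' j') =
          (\<Sum>i'<m. of_bool (i = i') * (\<Sum>j'<m. of_bool (j = j') * c i' j'))"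
        unfolding sum_distrib_left using ij m_le
        by (intro sum.cong refl) (auto simp: frame_orthonormal)
      also have "\<dots> = (\<Sum>i'<m. of_bool (i = i') * c i' j)"
        using ij by (simp add: of_bool_def if_distrib[of "\<lambda>x. x * _"] cong: if_cong)
      also have "\<dots> = c i j"
        using ij by (simp add: of_bool_def if_distrib[of "\<lambda>x. x * _"] cong: if_cong)
      finally show ?thesis .
    qed
    have "0 = second_fundamental_form g D H (e i) (e j) p f" for f
      using tg sec unfolding totally_geodesic_foliation_def by simp
    then have eq: "(\<lambda>f. \<Sum>k\<in>{m..<DIM('e)}. b k * e k p f) = (\<lambda>f. \<Sum>k\<in>{m..<DIM('e)}. 0 * e k p f)"
      using second_fundamental_form_V[OF sec, of p] delta by (simp add: b_def)
    have coeff: "g p (\<lambda>f. \<Sum>k\<in>{m..<DIM('e)}. c k * e k p f) (e k p) = c k" for c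
      using k by (intro orthonormal_coeff) (auto simp: frame_tangent frame_orthonormal)
    have "b k = 0" using coeff[of b] coeff[of "\<lambda>_. 0"] unfolding eq by simp
    then show "sc k i j + sc k j i = 0" by (simp add: b_def)
  qed
next
  assume "\<forall>k\<in>{m..<DIM('e)}. \<forall>i<m. \<forall>j<m. sc k i j + sc k j i = 0"
  then show "totally_geodesic_foliation \<A> g D V"
    unfolding totally_geodesic_foliation_def by (auto simp: second_fundamental_form_V fun_eq_iff)
qed

text \<open>The coefficient matrix of an orthonormal basis \<open>E\<^sub>r\<close> of \<open>V p\<close> with respect to the \<open>e\<^sub>i\<close> is
  orthogonal, so the trace may be computed with the \<open>e\<^sub>i\<close>.\<close>

lemma minimal_foliationI:
  assumes tr: "\<And>k. m \<le> k \<Longrightarrow> k < DIM('e) \<Longrightarrow> (\<Sum>i<m. sc k i i) = 0"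
  shows "minimal_foliation \<A> g D V"
  unfolding minimal_foliation_def
proof (intro allI impI)
  fix p and N :: nat and E :: "nat \<Rightarrow> 'g vfield"
  assume "\<forall>r<N. section_of \<A> V (E r)"
    and on: "\<forall>r<N. \<forall>s<N. g p (E r p) (E s p) = of_bool (r = s)"
    and span: "\<forall>v\<in>V p. \<exists>c. v = (\<lambda>f. \<Sum>r<N. c r * E r p f)"
  then have sec: "section_of \<A> V (E r)" and vf: "E r p \<in> tangent_space \<A> p" if "r < N" for r
    using that vector_field_tangent by (auto simp: section_of_def)
  define q where "q r i = g p (E r p) (e i p)" for r i
  \<comment> \<open>Expanding \<open>e i p\<close> in the spanning family \<open>E r p\<close> gives
    this Parseval identity without first identifying \<open>N\<close> with \<open>m\<close>.\<close>
  have qq: "(\<Sum>r<N. q r i * q r j) = of_bool (i = j)" if ij: "i < m" "j < m" for i j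
  proof -
    obtain c where c: "e i p = (\<lambda>f. \<Sum>r<N. c r * E r p f)" using span frame_in_V ij by blast
    have "c r = q r i" if "r < N" for r
    proof -
      have "c r = g p (e i p) (E r p)"
        unfolding c using vf on that by (intro orthonormal_coeff[symmetric]) auto
      then show ?thesis
        unfolding q_def using metric_sym[OF frame_tangent vf[OF that]] ij m_le by simp
    qed
    then have "g p (e i p) (e j p) = (\<Sum>r<N. q r i * g p (E r p) (e j p))"
      unfolding c using vf ij m_le metric_sum_left[of "{..<N}" "\<lambda>r. E r p" p "e j p" c] frame_tangent
      by simp
    then show ?thesis using ij m_le by (simp add: q_def frame_orthonormal)
  qed
  have "(\<Sum>r<N. second_fundamental_form g D H (E r) (E r) p f) = 0" for f
  proof -
    have "(\<Sum>r<N. second_fundamental_form g D H (E r) (E r) p f) =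
      (\<Sum>r<N. 1/2 * (\<Sum>k\<in>{m..<DIM('e)}.
        (\<Sum>i<m. \<Sum>j<m. q r i * q r j * (sc k i j + sc k j i)) * e k p f))"
      using sec by (simp add: second_fundamental_form_V q_def)
    also have "\<dots> = 1/2 * (\<Sum>k\<in>{m..<DIM('e)}. \<Sum>r<N.
        (\<Sum>i<m. \<Sum>j<m. q r i * q r j * (sc k i j + sc k j i)) * e k p f)"
      by (subst sum.swap) (simp add: sum_distrib_left)
    also have "\<dots> = 1/2 * (\<Sum>k\<in>{m..<DIM('e)}.
        (\<Sum>r<N. \<Sum>i<m. \<Sum>j<m. q r i * q r j * (sc k i j + sc k j i)) * e k p f)"
      by (simp add: sum_distrib_right)
    also have "\<dots> = 0"
    proof -
      have "(\<Sum>r<N. \<Sum>i<m. \<Sum>j<m. q r i * q r j * (sc k i j + sc k j i)) = 0"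
        if "k \<in> {m..<DIM('e)}" for k
      proof -
        have "(\<Sum>r<N. \<Sum>i<m. \<Sum>j<m. q r i * q r j * (sc k i j + sc k j i)) =
            (\<Sum>i<m. \<Sum>r<N. \<Sum>j<m. q r i * q r j * (sc k i j + sc k j i))"
          by (rule sum.swap)
        also have "\<dots> = (\<Sum>i<m. \<Sum>j<m. (\<Sum>r<N. q r i * q r j) * (sc k i j + sc k j i))"
          by (subst sum.swap) (simp add: sum_distrib_right)
        also have "\<dots> = (\<Sum>i<m. \<Sum>j<m. of_bool (i = j) * (sc k i j + sc k j i))"
          by (simp add: qq)
        also have "\<dots> = (\<Sum>i<m. 2 * sc k i i)"
          by (simp add: of_bool_def if_distrib[of "\<lambda>x. x * _"] cong: if_cong)
        finally show ?thesis using tr[of k] that by (simp add: sum_distrib_left[symmetric])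
      qed
      then show ?thesis by simp
    qed
    finally show ?thesis .
  qed
  then show "(\<lambda>f. \<Sum>r<N. second_fundamental_form g D H (E r) (E r) p f) = (\<lambda>f. 0)" by blast
qed

section \<open>Conformality in terms of structure constants\<close>

lemma conformal_coefficients:
  assumes N: "section_of \<A> V N" and sff: "\<And>Z W. section_of \<A> H Z \<Longrightarrow> section_of \<A> H W \<Longrightarrow>
      second_fundamental_form g D V Z W = vf_mult (\<lambda>p. g p (Z p) (W p)) N"
    and ij: "i \<in> {m..<DIM('e)}" "j \<in> {m..<DIM('e)}" and k: "k < m"
  shows "sc k i j + sc k j i = of_bool (i = j) * (2 * g p (N p) (e k p))"
proof -
  have NV: "N p \<in> V p" using N by (simp add: section_of_def)
  have vf: "vector_field \<A> (e i)" "vector_field \<A> (e j)" and kn: "k < DIM('e)"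
    using ij k m_le frame_vector_field by auto
  have sec: "section_of \<A> H (e i)" "section_of \<A> H (e j)"
    using ij vf frame_in_H by (auto simp: section_of_def)
  let ?v = "vf_add (D (e i) (e j)) (D (e j) (e i)) p"
  have vT: "?v \<in> tangent_space \<A> p" by (rule vf_add_connection_tangent[OF vf])
  have "1/2 * orthogonal_projection g V p ?v f = of_bool (i = j) * N p f" for f
    using sff[OF sec] ij frame_orthonormal[of i j p]
    unfolding second_fundamental_form_def vf_mult_def fun_eq_iff by (metis atLeastLessThan_iff)
  then have eq: "(\<lambda>f. \<Sum>l<m. g p ?v (e l p) * e l p f) =
      (\<lambda>f. (2 * of_bool (i = j)) * N p f + 0 * N p f)"
    unfolding projection_V[OF vT] by (simp add: fun_eq_iff field_simps)
  \<comment> \<open>Projecting to \<open>V\<close> does not change the inner product with the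
    vertical \<open>e k\<close>; the factor 2 undoes the 1/2 in the second fundamental form.\<close>
  have "g p ?v (e k p) = g p (\<lambda>f. \<Sum>l<m. g p ?v (e l p) * e l p f) (e k p)"
    using k m_le by (intro orthonormal_coeff[symmetric]) (auto simp: frame_tangent frame_orthonormal)
  also have "\<dots> = 2 * of_bool (i = j) * g p (N p) (e k p)"
    unfolding eq metric_lincomb_left[OF tangent_V[OF NV] tangent_V[OF NV] frame_tangent[OF kn]]
    by simp
  finally have "g p ?v (e k p) = of_bool (i = j) * (2 * g p (N p) (e k p))" by simp
  moreover have "g p ?v (e k p) = g p (D (e i) (e j) p) (e k p) + g p (D (e j) (e i) p) (e k p)"
    unfolding vf_add_def by (intro metric_add_left connection_tangent vf frame_tangent kn)
  ultimately show ?thesis using ij kn by (simp add: connection_frame_sym)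
qed

text \<open>The pair \<open>(m, m)\<close> determines the unknown field:
  \<open>g p (N p) (e k p) = sc k m m\<close>. After this elimination the horizontal part of the
  action of \<open>e k\<close> is a scalar plus a skew matrix.\<close>

lemma conformal_foliation_sc:
  assumes "conformal_foliation \<A> g D V"
    and "i \<in> {m..<DIM('e)}" "j \<in> {m..<DIM('e)}" "k < m"
  shows "sc k i j + sc k j i = of_bool (i = j) * (2 * sc k m m)"
proof -
  obtain N where N: "section_of \<A> V N" "\<And>Z W. section_of \<A> H Z \<Longrightarrow> section_of \<A> H W \<Longrightarrow>
      second_fundamental_form g D V Z W = vf_mult (\<lambda>p. g p (Z p) (W p)) N"
    using assms(1) unfolding conformal_foliation_def by blast
  show ?thesis
    using conformal_coefficients[OF N assms(2,3,4)] conformal_coefficients[OF N, of m m k] assms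
    by simp
qed

lemma conformal_imp_riemannian:
  assumes conf: "conformal_foliation \<A> g D V" and m: "m < DIM('e)"
    and trivial: "\<And>k. k < m \<Longrightarrow> sc k m m = 0"
  shows "riemannian_foliation \<A> g D V"
proof -
  obtain N where N: "section_of \<A> V N" and sff: "\<And>Z W. section_of \<A> H Z \<Longrightarrow> section_of \<A> H W \<Longrightarrow>
      second_fundamental_form g D V Z W = vf_mult (\<lambda>p. g p (Z p) (W p)) N"
    using conf unfolding conformal_foliation_def by blast
  have "N p = (\<lambda>f. 0)" for p
  proof -
    have "N p \<in> V p" using N by (simp add: section_of_def)
    moreover have "g p (N p) (e k p) = 0" if "k < m" for k
      using conformal_coefficients[OF N sff, of m m k p] trivial that m by simp
    ultimately show ?thesis using V_expansion[of "N p" p] by simp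
  qed
  then show ?thesis
    using sff unfolding riemannian_foliation_def vf_mult_def by simp
qed

end

section \<open>The structure constants of \<open>su(2) \<times> sl\<^sub>2(\<real>)\<close>\<close>

text \<open>The indices 0 to 5 stand for A, B, C, R, S, T, and 6, 7 for X, Y. Only brackets within
  \<kk> are prescribed; those with X or Y are constrained through the Jacobi identity.\<close>

locale su2_sl2_structure =
  fixes s :: "nat \<Rightarrow> nat \<Rightarrow> nat \<Rightarrow> real"
  assumes antisym: "\<And>i j k. \<lbrakk>i < 8; j < 8; k < 8\<rbrakk> \<Longrightarrow> s i j k = - s j i k"
    and jacobi: "\<And>i j k q. \<lbrakk>i < 8; j < 8; k < 8; q < 8\<rbrakk> \<Longrightarrow>
      (\<Sum>l<8. s i j l * s l k q) = (\<Sum>l<8. s j k l * s i l q) - (\<Sum>l<8. s i k l * s j l q)"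
    and su2: "\<And>k. k < 8 \<Longrightarrow> s 0 1 k = 2 * of_bool (k = 2)"
      "\<And>k. k < 8 \<Longrightarrow> s 2 0 k = 2 * of_bool (k = 1)"
      "\<And>k. k < 8 \<Longrightarrow> s 1 2 k = 2 * of_bool (k = 0)"
    and sl2: "\<And>k. k < 8 \<Longrightarrow> s 3 4 k = 2 * of_bool (k = 5)"
      "\<And>k. k < 8 \<Longrightarrow> s 5 3 k = 2 * of_bool (k = 4)"
      "\<And>k. k < 8 \<Longrightarrow> s 4 5 k = - 2 * of_bool (k = 3)"
    and comm: "\<And>i j k. \<lbrakk>i < 3; 3 \<le> j; j < 6; k < 8\<rbrakk> \<Longrightarrow> s i j k = 0"
begin

lemma table:
  assumes "k < 8"
  shows "s 1 0 k = - 2 * of_bool (k = 2)" "s 0 2 k = - 2 * of_bool (k = 1)"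
    "s 2 1 k = - 2 * of_bool (k = 0)" "s 4 3 k = - 2 * of_bool (k = 5)"
    "s 3 5 k = - 2 * of_bool (k = 4)" "s 5 4 k = 2 * of_bool (k = 3)"
  using antisym[of 1 0 k] antisym[of 0 2 k] antisym[of 2 1 k] antisym[of 4 3 k]
    antisym[of 3 5 k] antisym[of 5 4 k] su2 sl2 assms by (simp_all del: One_nat_def)

lemma self: "i < 8 \<Longrightarrow> k < 8 \<Longrightarrow> s i i k = 0"
  using antisym[of i i k] by simp

lemma comm': "\<lbrakk>i < 3; 3 \<le> j; j < 6; k < 8\<rbrakk> \<Longrightarrow> s j i k = 0"
  using antisym[of j i k] comm by simp

lemma sum8: "(\<Sum>l<8. f l) = f 0 + f 1 + f 2 + f 3 + f 4 + f 5 + f 6 + (f 7 :: real)" for f :: "nat \<Rightarrow> real"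
  by (simp add: eval_nat_numeral lessThan_Suc)

lemmas jacobi8 = jacobi[unfolded sum8]

lemmas structure_simps = su2 sl2 comm comm' table self

text \<open>The isotropy representation of the perfect Lie algebra \<open>\<kk>\<close> on \<open>\<mm>\<close> takes values in the
  abelian algebra of conformal matrices, hence vanishes.\<close>

lemma conformal_isotropy_trivial:
  assumes conf: "\<And>i j k. \<lbrakk>i \<in> {6..<8}; j \<in> {6..<8}; k < 6\<rbrakk> \<Longrightarrow>
      s k i j + s k j i = of_bool (i = j) * \<nu> k"
    and ijk: "i < 6" "j \<in> {6..<8}" "k \<in> {6..<8}"
  shows "s i j k = 0"
proof -
  \<comment> \<open>The matrix of \<open>e i\<close> on the plane is a multiple of the identity plus
    a multiple of the quarter turn, and such matrices commute.\<close>
  have c: "s i 7 6 = - s i 6 7" "s i 7 7 = s i 6 6" if "i < 6" for i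
    using conf[of 6 7 i] conf[of 6 6 i] conf[of 7 7 i] that by auto
  \<comment> \<open>Each basis vector of \<kk> is, up to a factor, a bracket of two others, so it
    acts by a commutator of commuting matrices. Intermediate terms in \<kk> drop out because \<kk>
    is closed under brackets.\<close>
  have "s 2 6 6 = 0" "s 2 6 7 = 0"
    using jacobi8[of 0 1 6 6] jacobi8[of 0 1 6 7] by (simp_all add: structure_simps c del: One_nat_def)
  moreover have "s 1 6 6 = 0" "s 1 6 7 = 0"
    using jacobi8[of 2 0 6 6] jacobi8[of 2 0 6 7] by (simp_all add: structure_simps c del: One_nat_def)
  moreover have "s 0 6 6 = 0" "s 0 6 7 = 0"
    using jacobi8[of 1 2 6 6] jacobi8[of 1 2 6 7] by (simp_all add: structure_simps c del: One_nat_def)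
  moreover have "s 5 6 6 = 0" "s 5 6 7 = 0"
    using jacobi8[of 3 4 6 6] jacobi8[of 3 4 6 7] by (simp_all add: structure_simps c)
  moreover have "s 4 6 6 = 0" "s 4 6 7 = 0"
    using jacobi8[of 5 3 6 6] jacobi8[of 5 3 6 7] by (simp_all add: structure_simps c)
  moreover have "s 3 6 6 = 0" "s 3 6 7 = 0"
    using jacobi8[of 4 5 6 6] jacobi8[of 4 5 6 7] by (simp_all add: structure_simps c)
  moreover have "i \<in> {0, 1, 2, 3, 4, 5}" "j \<in> {6, 7}" "k \<in> {6, 7}" using ijk by auto
  ultimately show ?thesis using c by (auto simp del: One_nat_def)
qed

text \<open>With trivial isotropy representation, \<open>ad Z\<close> restricts to a derivation of \<open>\<kk>\<close>. Derivations of
  \<open>su(2)\<close> are skew, while those of \<open>sl\<^sub>2\<close> are \<open>ad\<close> of some \<open>\<rho> R + \<sigma> S + \<tau> T\<close>, with the symmetric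
  part depending on \<open>\<sigma>\<close> and \<open>\<tau>\<close> only.\<close>

lemma derivation_symmetric_part:
  assumes iso: "\<And>i j k. \<lbrakk>i < 6; j \<in> {6..<8}; k \<in> {6..<8}\<rbrakk> \<Longrightarrow> s i j k = 0"
    and z: "z \<in> {6..<8}" and ij: "i < 6" "j < 6"
  shows "s i z j + s j z i = (if {i, j} = {3, 4} then 2 * s 4 z 3
    else if {i, j} = {3, 5} then 2 * s 5 z 3 else 0)"
proof -
  have z8: "z < 8" and iso': "s i z 6 = 0" "s i z 7 = 0" if "i < 6" for i using z iso that by auto
  note J = jacobi8[OF _ _ z8]
  note simps = structure_simps iso'
  \<comment> \<open>This and the five facts after it are the Leibniz rule for \<open>[_, Z]\<close>,
    applied to the bracket of the two basis vectors named in the label. The part in \<mm> vanishes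
    by \<open>iso'\<close>, the part in the other factor by commutation.\<close>
  have 01: "2 * s 2 z q = s 1 z 0 * s 0 0 q + s 1 z 1 * s 0 1 q + s 1 z 2 * s 0 2 q -
      (s 0 z 0 * s 1 0 q + s 0 z 1 * s 1 1 q + s 0 z 2 * s 1 2 q)" if "q < 6" for q
    using J[of 0 1 q] that by (simp add: simps del: One_nat_def)
  have 20: "2 * s 1 z q = s 0 z 0 * s 2 0 q + s 0 z 1 * s 2 1 q + s 0 z 2 * s 2 2 q -
      (s 2 z 0 * s 0 0 q + s 2 z 1 * s 0 1 q + s 2 z 2 * s 0 2 q)" if "q < 6" for q
    using J[of 2 0 q] that by (simp add: simps del: One_nat_def)
  have 12: "2 * s 0 z q = s 2 z 0 * s 1 0 q + s 2 z 1 * s 1 1 q + s 2 z 2 * s 1 2 q -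
      (s 1 z 0 * s 2 0 q + s 1 z 1 * s 2 1 q + s 1 z 2 * s 2 2 q)" if "q < 6" for q
    using J[of 1 2 q] that by (simp add: simps del: One_nat_def)
  have 34: "2 * s 5 z q = s 4 z 3 * s 3 3 q + s 4 z 4 * s 3 4 q + s 4 z 5 * s 3 5 q -
      (s 3 z 3 * s 4 3 q + s 3 z 4 * s 4 4 q + s 3 z 5 * s 4 5 q)" if "q < 6" for q
    using J[of 3 4 q] that by (simp add: simps del: One_nat_def)
  have 53: "2 * s 4 z q = s 3 z 3 * s 5 3 q + s 3 z 4 * s 5 4 q + s 3 z 5 * s 5 5 q -
      (s 5 z 3 * s 3 3 q + s 5 z 4 * s 3 4 q + s 5 z 5 * s 3 5 q)" if "q < 6" for q
    using J[of 5 3 q] that by (simp add: simps del: One_nat_def)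
  have 45: "- 2 * s 3 z q = s 5 z 3 * s 4 3 q + s 5 z 4 * s 4 4 q + s 5 z 5 * s 4 5 q -
      (s 4 z 3 * s 5 3 q + s 4 z 4 * s 5 4 q + s 4 z 5 * s 5 5 q)" if "q < 6" for q
    using J[of 4 5 q] that by (simp add: simps del: One_nat_def)
  \<comment> \<open>On the diagonal each entry equals the sum of the other two, which forces all
    three to vanish; off the diagonal the equations are the skewness relations. The diagonal
    argument recurs for the second factor.\<close>
  have su2: "s 0 z 0 = 0" "s 1 z 1 = 0" "s 2 z 2 = 0" "s 0 z 1 + s 1 z 0 = 0" "s 0 z 2 + s 2 z 0 = 0"
    "s 1 z 2 + s 2 z 1 = 0"
    using 01[of 0] 01[of 1] 01[of 2] 20[of 0] 20[of 1] 20[of 2] 12[of 0] 12[of 1] 12[of 2]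
    by (simp_all add: structure_simps del: One_nat_def)
  \<comment> \<open>The opposite sign in \<open>[S, T] = -2 R\<close> makes the pairs containing R
    symmetric, while (S, T) stays skew.\<close>
  have sl2: "s 3 z 3 = 0" "s 4 z 4 = 0" "s 5 z 5 = 0" "s 3 z 4 = s 4 z 3" "s 3 z 5 = s 5 z 3"
    "s 4 z 5 + s 5 z 4 = 0"
    using 34[of 3] 34[of 4] 34[of 5] 53[of 3] 53[of 4] 53[of 5] 45[of 3] 45[of 4] 45[of 5]
    by (simp_all add: structure_simps)
  \<comment> \<open>Both factors are perfect ideals, so a derivation preserves each: the right-hand
    sides of the Leibniz rule are brackets inside one factor.\<close>
  have mixed: "s i z j = 0" "s j z i = 0" if "i \<in> {0, 1, 2}" "j \<in> {3, 4, 5}" for i j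
    using that 01[of j] 20[of j] 12[of j] 34[of i] 53[of i] 45[of i]
    by (auto simp: structure_simps simp del: One_nat_def)
  show ?thesis
  proof (cases "i < 3 \<or> j < 3")
    case True
    then have ne: "{i, j} \<noteq> {3, 4}" "{i, j} \<noteq> {3, 5}" by (auto simp: doubleton_eq_iff)
    consider "i \<in> {0, 1, 2}" "j \<in> {0, 1, 2}" | "i \<in> {0, 1, 2}" "j \<in> {3, 4, 5}"
      | "j \<in> {0, 1, 2}" "i \<in> {3, 4, 5}"
      using True ij by fastforce
    then have "s i z j + s j z i = 0"
    proof cases
      case 1
      then show ?thesis using su2 by (elim insertE emptyE) (simp_all add: add.commute del: One_nat_def)
    qed (simp_all add: mixed del: insert_iff)
    then show ?thesis using ne by simp
  next
    case False
    then have "i \<in> {3, 4, 5}" "j \<in> {3, 4, 5}" using ij by auto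
    then show ?thesis
      using sl2 by (elim insertE emptyE) (simp_all add: doubleton_eq_iff add.commute)
  qed
qed

end

section \<open>The frame of the eight-dimensional group and the proof of the theorem\<close>

lemma nth_in_vf_span:
  assumes "i < length L"
  shows "L ! i \<in> vf_span L"
proof -
  have eq: "L ! i = (\<lambda>p f. \<Sum>j<length L. of_bool (j = i) * (L ! j) p f)"
    using assms by (intro ext) (simp add: of_bool_def if_distrib[of "\<lambda>x. x * _"] cong: if_cong)
  show ?thesis unfolding vf_span_def by (intro CollectI exI conjI TrueI) (rule eq)
qed

theorem theorem5p2:
  fixes G :: "'g::{t2_space,second_countable_topology} monoid"
    and \<A> :: "('g, real^8) atlas"
    and g :: "'g metric"
    and nabla :: "'g connection"
    and \<iota> :: "(complex^2^2) \<times> (real^2^2) \<Rightarrow> 'g"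
    and A B C R S T X Y :: "'g vfield"
    and \<kk> \<mm> :: "'g vfield set"
    and \<V> :: "'g distribution"
    and s14 s24 t14 t24 :: real
  assumes G: "lie_group G \<A>"
    and g: "left_invariant_metric G \<A> g"
    and nabla: "levi_civita \<A> g nabla"
    and K: "lie_subgroup_SU2_SL2 G \<A> \<iota>"
    and k: "\<kk> = lie_subalgebra G \<A> \<iota> (SU2 \<times> SL2)"
    and k_orthonormal: "orthonormal_fields G g [A, B, C, R, S, T]"
    and k_basis: "vf_span [A, B, C, R, S, T] = \<kk>"
    and su2: "vf_span [A, B, C] = lie_subalgebra G \<A> \<iota> (SU2 \<times> {mat 1})"
    and sl2: "vf_span [R, S, T] = lie_subalgebra G \<A> \<iota> ({mat 1} \<times> SL2)"
    and su2_brackets: "lie_bracket A B = vf_scale 2 C" "lie_bracket C A = vf_scale 2 B"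
      "lie_bracket B C = vf_scale 2 A"
    and sl2_brackets: "lie_bracket R S = vf_scale 2 T" "lie_bracket T R = vf_scale 2 S"
      "lie_bracket S T = vf_scale (-2) R"
    and commuting: "\<forall>E\<in>{A, B, C}. \<forall>F\<in>{R, S, T}. lie_bracket E F = vf_zero"
    and V: "\<V> = generated_distribution \<kk>"
    and conformal: "conformal_foliation \<A> g nabla \<V>"
    and m: "\<mm> = {Z \<in> lie_algebra G \<A>. \<forall>E\<in>\<kk>. lie_inner G g Z E = 0}"
    and m_orthonormal: "orthonormal_fields G g [X, Y]"
    and m_basis: "vf_span [X, Y] = \<mm>"
    and XY: "lie_inner G g (lie_bracket X Y) Y = 0"
    and s14: "s14 = lie_inner G g (lie_bracket S X) R"
    and s24: "s24 = lie_inner G g (lie_bracket S Y) R"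
    and t14: "t14 = lie_inner G g (lie_bracket T X) R"
    and t24: "t24 = lie_inner G g (lie_bracket T Y) R"
  shows "riemannian_foliation \<A> g nabla \<V> \<and> minimal_foliation \<A> g nabla \<V> \<and>
    (totally_geodesic_foliation \<A> g nabla \<V> \<longleftrightarrow> s14 = 0 \<and> s24 = 0 \<and> t14 = 0 \<and> t24 = 0)"
proof -
  define L where "L = [A, B, C, R, S, T, X, Y]"
  define L6 where "L6 = [A, B, C, R, S, T]"
  have L6: "L ! i = L6 ! i" if "i < 6" for i
    unfolding L_def L6_def using that nth_append[of "[A, B, C, R, S, T]" "[X, Y]" i] by simp
  have L2: "L ! i = [X, Y] ! (i - 6)" "i - 6 < 2" if "\<not> i < 6" "i < 8" for i
  proof -
    have "i = 6 \<or> i = 7" using that by auto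
    then show "L ! i = [X, Y] ! (i - 6)" "i - 6 < 2" by (auto simp: L_def)
  qed
  have kL: "L ! i \<in> \<kk>" if "i < 6" for i
    using nth_in_vf_span[of i L6] that unfolding L6[OF that] k_basis[symmetric] L6_def by simp
  have mL: "L ! i \<in> \<mm>" if "\<not> i < 6" "i < 8" for i
    using nth_in_vf_span[of "i - 6" "[X, Y]"] L2[OF that] m_basis by simp
  have kG: "Z \<in> lie_algebra G \<A>" if "Z \<in> \<kk>" for Z
    using that k unfolding lie_subalgebra_def by simp
  have LG: "L ! i \<in> lie_algebra G \<A>" if "i < 8" for i
    using kL[of i] mL[of i] that kG m by blast
  interpret left_invariant_levi_civita \<A> g nabla G
    using G g nabla by unfold_locales (auto simp: lie_group_def left_invariant_metric_def)
  have sym: "lie_inner G g Z W = lie_inner G g W Z"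
    if "Z \<in> lie_algebra G \<A>" "W \<in> lie_algebra G \<A>" for Z W
    unfolding lie_inner_def
    using that by (intro metric_sym vector_field_tangent lie_algebra_vector_field)
  \<comment> \<open>The elements of \<mm> are orthogonal to all of \<kk> by definition, so the two
    orthonormal families join into one frame.\<close>
  have cross: "lie_inner G g (L ! i) (L ! j) = 0" if "\<not> i < 6" "i < 8" "j < 6" for i j
    using mL[of i] kL[of j] that m by blast
  have on: "lie_inner G g (L ! i) (L ! j) = of_bool (i = j)" if ij: "i < 8" "j < 8" for i j
  proof (cases "i < 6"; cases "j < 6")
    assume "i < 6" "j < 6"
    then show ?thesis using k_orthonormal by (simp add: L6 L6_def orthonormal_fields_def)
  next
    assume "i < 6" "\<not> j < 6"
    then show ?thesis using cross[of j i] sym[OF LG LG] ij by simp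
  next
    assume "\<not> i < 6" "j < 6"
    then show ?thesis using cross[of i j] ij by auto
  next
    assume *: "\<not> i < 6" "\<not> j < 6"
    then have "lie_inner G g (L ! i) (L ! j) = of_bool (i - 6 = j - 6)"
      using m_orthonormal L2[of i] L2[of j] ij unfolding orthonormal_fields_def
      by (simp add: numeral_2_eq_2)
    then show ?thesis using * by auto
  qed
  have "\<V> p = {(\<lambda>f. \<Sum>i<6. c i * (L ! i) p f) | c. True}" for p
  proof -
    have "\<V> p = {E p | E. E \<in> vf_span L6}"
      unfolding V generated_distribution_def k_basis[symmetric] L6_def ..
    also have "\<dots> = {(\<lambda>f. \<Sum>i<length L6. c i * (L6 ! i) p f) | c. True}"
      unfolding vf_span_def by auto
    also have "length L6 = 6" by (simp add: L6_def)
    finally show ?thesis by (simp add: L6)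
  qed
  then interpret left_invariant_foliation \<A> g nabla G "\<lambda>i. L ! i" 6 \<V>
    using LG on by unfold_locales auto
  have nth: "L ! 0 = A" "L ! 1 = B" "L ! 2 = C" "L ! 3 = R" "L ! 4 = S" "L ! 5 = T" "L ! 6 = X" "L ! 7 = Y"
    by (simp_all add: L_def)
  interpret su2_sl2_structure sc
  proof
    show "sc i j k = - sc j i k" if "i < 8" "j < 8" "k < 8" for i j k
      using sc_antisym[of i j k] that by simp
    show "(\<Sum>l<8. sc i j l * sc l k q) = (\<Sum>l<8. sc j k l * sc i l q) - (\<Sum>l<8. sc i k l * sc j l q)"
      if "i < 8" "j < 8" "k < 8" "q < 8" for i j k q
      using sc_jacobi[of i j k q] that by simp
    fix k :: nat assume k: "k < 8"
    have sc: "sc i j k = c * of_bool (k = l)"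
      if "i < 8" "j < 8" "l < 8" "lie_bracket (L ! i) (L ! j) = vf_scale c (L ! l)" for i j l c
      using sc_eqI[of i j k l c] that k by simp
    show "sc 0 1 k = 2 * of_bool (k = 2)"
      by (rule sc) (simp_all add: nth su2_brackets(1) del: One_nat_def)
    show "sc 2 0 k = 2 * of_bool (k = 1)"
      by (rule sc) (simp_all add: nth su2_brackets(2) del: One_nat_def)
    show "sc 1 2 k = 2 * of_bool (k = 0)"
      by (rule sc) (simp_all add: nth su2_brackets(3) del: One_nat_def)
    show "sc 3 4 k = 2 * of_bool (k = 5)"
      by (rule sc) (simp_all add: nth sl2_brackets(1) del: One_nat_def)
    show "sc 5 3 k = 2 * of_bool (k = 4)"
      by (rule sc) (simp_all add: nth sl2_brackets(2) del: One_nat_def)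
    show "sc 4 5 k = - 2 * of_bool (k = 3)"
      by (rule sc) (simp_all add: nth sl2_brackets(3) del: One_nat_def)
    fix i j :: nat assume ij: "i < 3" "3 \<le> j" "j < 6"
    then have "i \<in> {0, 1, 2}" "j \<in> {3, 4, 5}" by auto
    then have "L ! i \<in> {A, B, C}" "L ! j \<in> {R, S, T}" using nth by auto
    then have "lie_bracket (L ! i) (L ! j) = vf_zero" using commuting by blast
    then show "sc i j k = 0" using ij k by (intro sc_eq_0I) auto
  qed
  \<comment> \<open>The scalar part of the action of \<open>e k\<close> on the plane is read off at
    X, which has index 6.\<close>
  have iso: "sc i j k = 0" if "i < 6" "j \<in> {6..<8}" "k \<in> {6..<8}" for i j k
    using conformal_foliation_sc[OF conformal] that
    by (intro conformal_isotropy_trivial[of "\<lambda>k. 2 * sc k 6 6"]) simp_all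
  \<comment> \<open>The derivation treated above is \<open>[_, Z]\<close>; passing to
    \<open>ad Z\<close> reverses the sign.\<close>
  have sym_part: "sc z i j + sc z j i = (if {i, j} = {3, 4} then - 2 * sc 4 z 3
      else if {i, j} = {3, 5} then - 2 * sc 5 z 3 else 0)" if "z \<in> {6..<8}" "i < 6" "j < 6" for z i j
    using derivation_symmetric_part[OF iso that] antisym[of i z j] antisym[of j z i] that
    by (auto split: if_splits)
  have "riemannian_foliation \<A> g nabla \<V>"
    using conformal_imp_riemannian[OF conformal] iso by simp
  moreover have "minimal_foliation \<A> g nabla \<V>"
  proof (rule minimal_foliationI)
    fix k assume "6 \<le> k" "k < DIM(real^8)"
    \<comment> \<open>For \<open>i = j\<close> the set \<open>{i, j}\<close> is a singleton and
      matches neither exceptional pair, so the trace vanishes term by term.\<close>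
    then have "sc k i i = 0" if "i < 6" for i
      using sym_part[of k i i] that
      by (auto simp: doubleton_eq_iff simp del: insert_absorb2 split: if_splits)
    then show "(\<Sum>i<6. sc k i i) = 0" by simp
  qed
  moreover have "totally_geodesic_foliation \<A> g nabla \<V> \<longleftrightarrow>
      (\<forall>z\<in>{6..<8}. sc 4 z 3 = 0 \<and> sc 5 z 3 = 0)"
  proof
    assume "totally_geodesic_foliation \<A> g nabla \<V>"
    then have "sc z i j + sc z j i = 0" if "z \<in> {6..<8}" "i < 6" "j < 6" for z i j
      using that unfolding totally_geodesic_iff by simp
    \<comment> \<open>The index pairs (3, 4) and (3, 5) are (R, S) and (R, T), where the symmetric
      part is -2 times the coefficient in question.\<close>
    from this[of _ 3 4] this[of _ 3 5] show "\<forall>z\<in>{6..<8}. sc 4 z 3 = 0 \<and> sc 5 z 3 = 0"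
      using sym_part[of _ 3 4] sym_part[of _ 3 5] by (auto simp: doubleton_eq_iff)
  next
    assume "\<forall>z\<in>{6..<8}. sc 4 z 3 = 0 \<and> sc 5 z 3 = 0"
    then show "totally_geodesic_foliation \<A> g nabla \<V>"
      unfolding totally_geodesic_iff by (auto simp: sym_part)
  qed
  moreover have "s14 = sc 4 6 3" "s24 = sc 4 7 3" "t14 = sc 5 6 3" "t24 = sc 5 7 3"
    by (simp_all add: sc_def nth s14 s24 t14 t24)
  moreover have "{6..<8} = {6, 7 :: nat}" by auto
  ultimately show ?thesis by auto
qed

end
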